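(* Fix an integer $m\ge1$. Let $L_n$ be the total number of loops in $G_m^n$ and $\mathbb E[L_n\mid\mathbf W]$ its conditional expectation given $\mathbf W$. For every $\varepsilon\in(0,3/2)$ and $\delta\in(0,1)$, as $n\to\infty$, $$\mathbb P\Bigl(\bigl|L_n-\mathbb E[L_n\mid\mathbf W]\bigr|\ge\varepsilon\,\mathbb E[L_n\mid\mathbf W]\Bigr)=O\bigl((\log n)^{-(1-\delta)}\bigr).$$
   Context: Bollobás–Riordan preferential attachment multigraph $G_m^n$. Let $w_1,\dots,w_{mn+1}$ be independent exponential random variables with mean $1$, $W_k=\sum_{i=1}^k w_i$, $W_0=0$, $\mathbf W=\{W_k\}$. Put $R_k=W_k/W_{mn+1}$ for $k=1,\dots,mn$, $R_0=0$. Conditionally on $\mathbf W$, let $\ell_1,\dots,\ell_{mn}$ be independent, $\ell_k$ having density $\frac{1}{2\sqrt{R_k x}}$ on $(0,R_k]$. The vertex set of $G_m^n$ is $[n]$; vertex $j$ is identified with the interval $(R_{m(j-1)},R_{mj}]$. For each $k\in[mn]$ there is one edge joining the vertex containing $R_k$ with the vertex containing $\ell_k$ (a loop if these coincide); $L_n$ is the number of $k$ for which it is a loop. The constant in $O(\cdot)$ may depend on $m,\varepsilon,\delta$. *)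

theory Defs
  imports "HOL-Probability.Probability" "HOL-Library.Landau_Symbols"
begin

definition partial_sum :: "(nat \<Rightarrow> 'a \<Rightarrow> real) \<Rightarrow> nat \<Rightarrow> 'a \<Rightarrow> real" where
  "partial_sum w k \<omega> = (\<Sum>i=1..k. w i \<omega>)"

definition point_R :: "nat \<Rightarrow> nat \<Rightarrow> (nat \<Rightarrow> 'a \<Rightarrow> real) \<Rightarrow> nat \<Rightarrow> 'a \<Rightarrow> real" where
  "point_R m n w k \<omega> = partial_sum w k \<omega> / partial_sum w (m * n + 1) \<omega>"

definition sigma_W :: "nat \<Rightarrow> nat \<Rightarrow> 'a measure \<Rightarrow> (nat \<Rightarrow> 'a \<Rightarrow> real) \<Rightarrow> 'a measure" where
  "sigma_W m n M w =
     vimage_algebra (space M) (\<lambda>\<omega>. \<lambda>k\<in>{0..m * n + 1}. partial_sum w k \<omega>)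
       (\<Pi>\<^sub>M k\<in>{0..m * n + 1}. borel)"

definition attach_density :: "real \<Rightarrow> real \<Rightarrow> real" where
  "attach_density r x = (if x \<in> {0<..r} then 1 / (2 * sqrt (r * x)) else 0)"

text \<open>
  The last assumption says that, conditionally on the partial sums, the \<open>l k\<close> are independent
  with densities \<open>attach_density (R\<^sub>k)\<close>: the conditional probability of every measurable
  rectangle is the product of the integrals of the densities over its sides.
\<close>

locale bollobas_riordan = prob_space M for M :: "'a measure" +
  fixes m n :: nat and w l :: "nat \<Rightarrow> 'a \<Rightarrow> real"
  assumes indep_w: "indep_vars (\<lambda>_. borel) w {1..m * n + 1}"
    and exponential_w:
      "\<And>i. i \<in> {1..m * n + 1} \<Longrightarrow> distributed M lborel (w i) (exponential_density 1)"
    and measurable_l: "\<And>k. k \<in> {1..m * n} \<Longrightarrow> l k \<in> borel_measurable M"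
    and conditional_law_l:
      "\<And>A. (\<And>k. k \<in> {1..m * n} \<Longrightarrow> A k \<in> sets borel) \<Longrightarrow>
         AE \<omega> in M.
           real_cond_exp M (sigma_W m n M w)
             (indicator {\<omega> \<in> space M. \<forall>k\<in>{1..m * n}. l k \<omega> \<in> A k}) \<omega> =
           (\<Prod>k=1..m * n. LINT x:A k|lborel. attach_density (point_R m n w k \<omega>) x)"

definition vertex_interval ::
    "nat \<Rightarrow> nat \<Rightarrow> (nat \<Rightarrow> 'a \<Rightarrow> real) \<Rightarrow> nat \<Rightarrow> 'a \<Rightarrow> real set" where
  "vertex_interval m n w j \<omega> = {point_R m n w (m * (j - 1)) \<omega> <.. point_R m n w (m * j) \<omega>}"

definition edge_joins ::
    "nat \<Rightarrow> nat \<Rightarrow> (nat \<Rightarrow> 'a \<Rightarrow> real) \<Rightarrow> (nat \<Rightarrow> 'a \<Rightarrow> real) \<Rightarrow> 'a \<Rightarrow>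
     nat \<Rightarrow> nat \<Rightarrow> nat \<Rightarrow> bool" where
  "edge_joins m n w l \<omega> k i j \<longleftrightarrow>
     i \<in> {1..n} \<and> j \<in> {1..n} \<and>
     point_R m n w k \<omega> \<in> vertex_interval m n w i \<omega> \<and> l k \<omega> \<in> vertex_interval m n w j \<omega>"

definition num_loops ::
    "nat \<Rightarrow> nat \<Rightarrow> (nat \<Rightarrow> 'a \<Rightarrow> real) \<Rightarrow> (nat \<Rightarrow> 'a \<Rightarrow> real) \<Rightarrow> 'a \<Rightarrow> real" where
  "num_loops m n w l \<omega> = real (card {k \<in> {1..m * n}. \<exists>j. edge_joins m n w l \<omega> k j j})"

definition cond_num_loops ::
    "nat \<Rightarrow> nat \<Rightarrow> 'a measure \<Rightarrow> (nat \<Rightarrow> 'a \<Rightarrow> real) \<Rightarrow> (nat \<Rightarrow> 'a \<Rightarrow> real) \<Rightarrow> 'a \<Rightarrow> real" where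
  "cond_num_loops m n M w l = real_cond_exp M (sigma_W m n M w) (num_loops m n w l)"

end

theory Submission
  imports Defs
begin

text \<open>
  Given \<open>\<^bold>W\<close>, the loop indicators are independent, so the conditional variance of \<open>L\<^sub>n\<close> is at
  most its conditional mean \<open>\<mu>\<close>, and Chebyshev's inequality bounds the conditional deviation
  probability by \<open>1 / (\<epsilon>\<^sup>2 \<mu>)\<close>.  Edge \<open>k\<close> is a loop whenever \<open>\<ell>\<^sub>k > R\<^bsub>k-1\<^esub>\<close>, and the attachment
  density is at least \<open>1 / (2 R\<^sub>k)\<close> on \<open>(0, R\<^sub>k]\<close>; hence \<open>\<mu> \<ge> \<Sum>\<^sub>k w\<^sub>k / (2 W\<^sub>k)\<close>.  The part of this
  sum over the dyadic block \<open>(2\<^sup>i, 2\<^bsup>i+1\<^esup>]\<close> is at least half of \<open>1 - W\<^bsub>2^i\<^esub> / W\<^bsub>2^(i+1)\<^esub>\<close>.  As \<open>W\<^sub>k\<close> has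
  mean and variance \<open>k\<close>, block \<open>i\<close> contributes a constant except with probability \<open>O(2\<^sup>-\<^sup>i)\<close>.
  Using only the upper half of the about \<open>log\<^sub>2 n\<close> blocks, \<open>\<mu>\<close> is of order \<open>log n\<close> except
  with probability \<open>O(1 / log n)\<close>.  The resulting bound \<open>O(1 / log n)\<close> is stronger than needed.
\<close>

section \<open>Disintegration over a sub-sigma-algebra: from rectangles to random sections\<close>

text \<open>Both sides are measures in \<open>B\<close>. They agree on the rectangles, an
  intersection-stable generator that contains the whole space, and there the left side is finite; so
  they coincide. \<open>H\<close> is only required to lie in \<open>M\<close>, so that it can carry
  conditions on variables that are not \<open>F\<close>-measurable.\<close>

lemma (in finite_measure) emeasure_section_eq:
  fixes X :: "'a \<Rightarrow> real" and g :: "'a \<times> real \<Rightarrow> ennreal"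
  assumes sub: "subalgebra M F" and H[measurable]: "H \<in> sets M"
    and X[measurable]: "X \<in> borel_measurable M"
    and g[measurable]: "g \<in> borel_measurable (F \<Otimes>\<^sub>M borel)"
    and rect: "\<And>G A. G \<in> sets F \<Longrightarrow> A \<in> sets borel \<Longrightarrow>
      emeasure M {\<omega> \<in> G \<inter> H. X \<omega> \<in> A} =
        (\<integral>\<^sup>+\<omega>. (\<integral>\<^sup>+x. indicator (G \<times> A) (\<omega>, x) * g (\<omega>, x) \<partial>lborel) \<partial>M)"
    and B[measurable]: "B \<in> sets (F \<Otimes>\<^sub>M borel)"
  shows "emeasure M {\<omega> \<in> H. (\<omega>, X \<omega>) \<in> B} =
    (\<integral>\<^sup>+\<omega>. (\<integral>\<^sup>+x. indicator B (\<omega>, x) * g (\<omega>, x) \<partial>lborel) \<partial>M)"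
proof -
  \<comment> \<open>\<open>subalgebra\<close> compares only spaces and sets, so \<open>F\<close> may
    carry any measure. \<open>N\<close> has the sets of \<open>F\<close> and the measure of
    \<open>M\<close>.\<close>
  define N where "N = restr_to_subalg M F"
  have spF: "space F = space M" and FM: "sets F \<subseteq> sets M"
    using sub by (auto simp: subalgebra_def)
  have spN: "space N = space M" and setsN[measurable_cong]: "sets N = sets F"
    using sub by (auto simp: N_def space_restr_to_subalg sets_restr_to_subalg)
  have id[measurable]: "(\<lambda>\<omega>. \<omega>) \<in> M \<rightarrow>\<^sub>M F"
    using sub by (auto simp: measurable_def subalgebra_def)
  have id'[measurable]: "(\<lambda>\<omega>. \<omega>) \<in> M \<rightarrow>\<^sub>M N"
    using id measurable_cong_sets[OF refl setsN] by blast
  define P where "P = distr (density M (indicator H)) (N \<Otimes>\<^sub>M lborel) (\<lambda>\<omega>. (\<omega>, X \<omega>))"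
  define Q where "Q = density (N \<Otimes>\<^sub>M lborel) g"
  have P: "emeasure P C = emeasure M {\<omega> \<in> H. (\<omega>, X \<omega>) \<in> C}"
    if C: "C \<in> sets (F \<Otimes>\<^sub>M borel)" for C
  proof -
    have [measurable, simp]: "C \<in> sets (N \<Otimes>\<^sub>M borel)"
      using C sets_pair_measure_cong[OF setsN refl] by blast
    have "emeasure P C = (\<integral>\<^sup>+\<omega>. indicator H \<omega> * indicator ((\<lambda>\<omega>. (\<omega>, X \<omega>)) -` C \<inter> space M) \<omega> \<partial>M)"
      unfolding P_def by (subst emeasure_distr) (simp_all add: emeasure_density)
    also have "\<dots> = (\<integral>\<^sup>+\<omega>. indicator {\<omega> \<in> H. (\<omega>, X \<omega>) \<in> C} \<omega> \<partial>M)"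
      by (intro nn_integral_cong) (auto split: split_indicator)
    also have "\<dots> = emeasure M {\<omega> \<in> H. (\<omega>, X \<omega>) \<in> C}"
    proof (rule nn_integral_indicator)
      have "{\<omega> \<in> H. (\<omega>, X \<omega>) \<in> C} = H \<inter> ((\<lambda>\<omega>. (\<omega>, X \<omega>)) -` C \<inter> space M)"
        using sets.sets_into_space[OF H] by auto
      then show "{\<omega> \<in> H. (\<omega>, X \<omega>) \<in> C} \<in> sets M" by simp
    qed
    finally show ?thesis .
  qed
  have Q: "emeasure Q C = (\<integral>\<^sup>+\<omega>. (\<integral>\<^sup>+x. indicator C (\<omega>, x) * g (\<omega>, x) \<partial>lborel) \<partial>M)"
    if C[measurable]: "C \<in> sets (F \<Otimes>\<^sub>M borel)" for C
  proof -
    have [measurable, simp]: "C \<in> sets (N \<Otimes>\<^sub>M borel)"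
      using C sets_pair_measure_cong[OF setsN refl] by blast
    have "emeasure Q C = (\<integral>\<^sup>+z. g z * indicator C z \<partial>(N \<Otimes>\<^sub>M lborel))"
      unfolding Q_def by (rule emeasure_density) simp_all
    also have "\<dots> = (\<integral>\<^sup>+\<omega>. (\<integral>\<^sup>+x. g (\<omega>, x) * indicator C (\<omega>, x) \<partial>lborel) \<partial>N)"
      by (rule lborel.nn_integral_fst[symmetric]) simp
    also have "\<dots> = (\<integral>\<^sup>+\<omega>. (\<integral>\<^sup>+x. g (\<omega>, x) * indicator C (\<omega>, x) \<partial>lborel) \<partial>M)"
      unfolding N_def by (rule nn_integral_subalgebra2[OF sub]) simp
    finally show ?thesis by (simp add: mult.commute)
  qed
  have "P = Q"
  proof (rule measure_eqI_generator_eq[where \<Omega> = "space F \<times> space lborel"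
        and E = "{a \<times> b | a b. a \<in> sets F \<and> b \<in> sets lborel}"
        and A = "\<lambda>_. space F \<times> space lborel"])
    show "emeasure P Y = emeasure Q Y"
      if Y: "Y \<in> {a \<times> b | a b. a \<in> sets F \<and> b \<in> sets lborel}" for Y
    proof -
      from Y obtain G A where Y_eq: "Y = G \<times> A" and GA: "G \<in> sets F" "A \<in> sets lborel"
        by blast
      have "{\<omega> \<in> H. (\<omega>, X \<omega>) \<in> G \<times> A} = {\<omega> \<in> G \<inter> H. X \<omega> \<in> A}" by auto
      with rect[OF GA(1), of A] GA show ?thesis unfolding Y_eq by (simp add: P Q)
    qed
    show "sets P = sigma_sets (space F \<times> space lborel) {a \<times> b | a b. a \<in> sets F \<and> b \<in> sets lborel}"
      "sets Q = sigma_sets (space F \<times> space lborel) {a \<times> b | a b. a \<in> sets F \<and> b \<in> sets lborel}"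
      unfolding P_def Q_def sets_distr sets_density
      by (simp_all only: sets_pair_measure setsN spN spF)
    show "emeasure P (space F \<times> space lborel) \<noteq> \<infinity>" for i :: nat
      by (simp add: P)

    show "range (\<lambda>_::nat. space F \<times> space lborel) \<subseteq> {a \<times> b | a b. a \<in> sets F \<and> b \<in> sets lborel}"
      by blast
  qed (simp_all only: Int_stable_pair_measure_generator pair_measure_closed, simp)
  then show ?thesis using P[OF B] Q[OF B] by simp
qed

section \<open>The attachment density and the mass it gives to a set\<close>

lemma attach_density_nonneg: "0 \<le> attach_density r x"
  by (simp add: attach_density_def)

lemma attach_density_measurable [measurable]:
  assumes [measurable]: "f \<in> borel_measurable N" "g \<in> borel_measurable N"
  shows "(\<lambda>z. attach_density (f z) (g z)) \<in> borel_measurable N"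
  unfolding attach_density_def greaterThanAtMost_iff by measurable

text \<open>The density is unbounded at 0, so the fundamental theorem is applied on the open
  interval: the antiderivative \<open>sqrt (x / r)\<close> has the one-sided limits 0 at 0 and 1 at
  \<open>r\<close>. The endpoint \<open>r\<close> is a null set.\<close>

lemma nn_integral_attach_density:
  assumes "0 < r"
  shows "(\<integral>\<^sup>+x. attach_density r x \<partial>lborel) = 1"
proof -
  let ?f = "\<lambda>x. 1 / (2 * sqrt (r * x))" and ?F = "\<lambda>x. sqrt (x / r)"
  have 1: "((?F \<circ> real_of_ereal) \<longlongrightarrow> 0) (at_right (ereal 0))"
    unfolding ereal_tendsto_simps using assms by (auto intro!: tendsto_eq_intros)
  have 2: "((?F \<circ> real_of_ereal) \<longlongrightarrow> 1) (at_left (ereal r))"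
    unfolding ereal_tendsto_simps using assms by (auto intro!: tendsto_eq_intros)
  have D: "(?F has_real_derivative ?f x) (at x)" if "0 < x" for x
    using assms that
    by (auto intro!: derivative_eq_intros simp: real_sqrt_divide real_sqrt_mult field_simps)
  have C: "isCont ?f x" if "0 < x" for x
    using assms that by (auto intro!: continuous_intros)
  have ftc: "set_integrable lborel (einterval (ereal 0) (ereal r)) ?f"
    "(LBINT x=ereal 0..ereal r. ?f x) = 1 - 0"
    by (rule interval_integral_FTC_nonneg[OF _ _ _ _ 1 2]; use assms D C in auto)+
  have ae: "AE x in lborel. indicator {0<..<r} x * ?f x = attach_density r x"
    using AE_lborel_singleton[of r]
    by eventually_elim (auto simp: attach_density_def split: split_indicator)
  have int: "integrable lborel (\<lambda>x. indicator {0<..<r} x * ?f x)"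
    using ftc(1) by (simp add: set_integrable_def einterval_eq)
  have "(\<integral>\<^sup>+x. attach_density r x \<partial>lborel) = (\<integral>\<^sup>+x. ennreal (indicator {0<..<r} x * ?f x) \<partial>lborel)"
    using ae by (intro nn_integral_cong_AE) auto
  also have "\<dots> = ennreal (LINT x|lborel. indicator {0<..<r} x * ?f x)"
    using assms by (intro nn_integral_eq_integral[OF int]) (auto split: split_indicator)
  also have "(LINT x|lborel. indicator {0<..<r} x * ?f x) = 1"
    using ftc(2) assms
    by (simp add: interval_lebesgue_integral_def einterval_eq set_lebesgue_integral_def)
  finally show ?thesis by simp
qed

text \<open>For \<open>r \<le> 0\<close> the interval \<open>{0<..r}\<close> is empty and the
  density vanishes. A bound for every \<open>r\<close> makes masses bounded at every point of the
  space, whereas positivity of the \<open>R k\<close> is known only almost everywhere.\<close>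

lemma nn_integral_attach_density_le: "(\<integral>\<^sup>+x. attach_density r x \<partial>lborel) \<le> 1"
proof (cases "0 < r")
  case False
  then have "attach_density r = (\<lambda>_. 0)" by (auto simp: attach_density_def fun_eq_iff)
  then show ?thesis by simp
qed (simp add: nn_integral_attach_density)

text \<open>For positive \<open>r\<close> this is the conditional probability of
  \<open>l k \<in> A\<close> given \<open>R k = r\<close>. Values in \<open>ennreal\<close> keep the
  Tonelli arguments free of integrability conditions.\<close>

definition attach_mass :: "real \<Rightarrow> real set \<Rightarrow> ennreal" where
  "attach_mass r A = (\<integral>\<^sup>+x. indicator A x * ennreal (attach_density r x) \<partial>lborel)"

lemma attach_mass_le_1: "attach_mass r A \<le> 1"
proof -
  have "attach_mass r A \<le> (\<integral>\<^sup>+x. attach_density r x \<partial>lborel)"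
    unfolding attach_mass_def by (intro nn_integral_mono) (auto split: split_indicator)
  then show ?thesis using nn_integral_attach_density_le[of r] by (rule order_trans)
qed

lemma attach_mass_UNIV: "0 < r \<Longrightarrow> attach_mass r UNIV = 1"
  by (simp add: attach_mass_def nn_integral_attach_density)

lemma ennreal_enn2real_attach_mass: "ennreal (enn2real (attach_mass r A)) = attach_mass r A"
  using attach_mass_le_1[of r A] by (metis ennreal_enn2real ennreal_one_less_top le_less_trans)

lemma enn2real_attach_mass_le_1: "enn2real (attach_mass r A) \<le> 1"
  using attach_mass_le_1[of r A] enn2real_mono[of _ 1] by fastforce

text \<open>Translates the Bochner integrals of the assumption \<open>conditional_law_l\<close> into
  \<open>attach_mass\<close>.\<close>

lemma set_integral_attach_density:
  assumes [measurable]: "A \<in> sets borel"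
  shows "(LINT x:A|lborel. attach_density r x) = enn2real (attach_mass r A)"
proof -
  have "attach_mass r A = (\<integral>\<^sup>+x. ennreal (indicator A x * attach_density r x) \<partial>lborel)"
    unfolding attach_mass_def by (intro nn_integral_cong) (auto split: split_indicator)
  moreover have "(LINT x:A|lborel. attach_density r x) =
      enn2real (\<integral>\<^sup>+x. ennreal (indicator A x * attach_density r x) \<partial>lborel)"
    unfolding set_lebesgue_integral_def real_scaleR_def
    by (intro integral_eq_nn_integral) (auto simp: attach_density_nonneg)
  ultimately show ?thesis by simp
qed

text \<open>\<open>B\<close> encodes a random set: its section at \<omega> may vary with the
  information in \<open>F\<close>. The mass of the section is a partial integral of a jointly
  measurable function.\<close>

lemma attach_mass_section_measurable:
  assumes [measurable]: "f \<in> borel_measurable F" "B \<in> sets (F \<Otimes>\<^sub>M borel)"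
  shows "(\<lambda>\<omega>. attach_mass (f \<omega>) (Pair \<omega> -` B)) \<in> borel_measurable F"
proof -
  have "(\<lambda>\<omega>. attach_mass (f \<omega>) (Pair \<omega> -` B)) =
      (\<lambda>\<omega>. \<integral>\<^sup>+x. indicator B (\<omega>, x) * ennreal (attach_density (f \<omega>) x) \<partial>lborel)"
    unfolding attach_mass_def by (intro ext nn_integral_cong) (auto split: split_indicator)
  then show ?thesis by simp
qed

section \<open>Measurability and positivity of the partial sums\<close>

context bollobas_riordan
begin

abbreviation "F \<equiv> sigma_W m n M w"
abbreviation "R \<equiv> point_R m n w"

lemma w_measurable: "i \<in> {1..m * n + 1} \<Longrightarrow> w i \<in> borel_measurable M"
  using distributed_measurable[OF exponential_w] by simp

lemma AE_w_pos: "AE \<omega> in M. \<forall>i\<in>{1..m * n + 1}. 0 < w i \<omega>"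
proof (rule AE_finite_allI)
  fix i assume "i \<in> {1..m * n + 1}"
  then have D: "distributed M lborel (w i) (exponential_density 1)" by (rule exponential_w)
  \<comment> \<open>The density is positive at 0 too, so this point has to be removed as a null
    set.\<close>
  have "AE x in lborel. 0 < exponential_density 1 x \<longrightarrow> 0 < x"
    using AE_lborel_singleton[of 0] by eventually_elim (auto simp: exponential_density_def)
  then show "AE \<omega> in M. 0 < w i \<omega>"
    by (subst distributed_AE2[OF D]) auto
qed simp

lemma partial_sum_measurable:
  assumes "k \<le> m * n + 1"
  shows "partial_sum w k \<in> borel_measurable M"
  using assms unfolding partial_sum_def[abs_def] by (auto intro!: borel_measurable_sum w_measurable)

lemma subalgebra_sigma_W: "subalgebra M F"
proof -
  have "(\<lambda>\<omega>. \<lambda>k\<in>{0..m * n + 1}. partial_sum w k \<omega>) \<in> M \<rightarrow>\<^sub>M (\<Pi>\<^sub>M k\<in>{0..m * n + 1}. borel)"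
    by (intro measurable_restrict partial_sum_measurable) auto
  then show ?thesis
    by (simp add: subalgebra_def sigma_W_def measurable_iff_sets)
qed

sublocale finite_measure_subalgebra M F
  by unfold_locales (rule subalgebra_sigma_W)

lemma space_F: "space F = space M"
  using subalg by (simp add: subalgebra_def)

lemma partial_sum_measurable_F:
  assumes "k \<le> m * n + 1"
  shows "partial_sum w k \<in> borel_measurable F"
proof -
  have "(\<lambda>\<omega>. \<lambda>k\<in>{0..m * n + 1}. partial_sum w k \<omega>) \<in> F \<rightarrow>\<^sub>M (\<Pi>\<^sub>M k\<in>{0..m * n + 1}. borel)"
    unfolding sigma_W_def by (rule measurable_vimage_algebra1) (auto simp: space_PiM)
  from measurable_compose[OF this measurable_component_singleton, of k]
  show ?thesis using assms by simp
qed

lemma R_measurable_F: "k \<le> m * n + 1 \<Longrightarrow> R k \<in> borel_measurable F"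
  unfolding point_R_def[abs_def]
  by (intro borel_measurable_divide partial_sum_measurable_F) auto

lemma partial_sum_pos:
  assumes "\<forall>i\<in>{1..m * n + 1}. 0 < w i \<omega>" "1 \<le> k" "k \<le> m * n + 1"
  shows "0 < partial_sum w k \<omega>"
  unfolding partial_sum_def using assms by (intro sum_pos) auto

lemma AE_R_pos: "AE \<omega> in M. \<forall>k\<in>{1..m * n}. 0 < R k \<omega>"
  using AE_w_pos
proof eventually_elim
  case (elim \<omega>)
  then show ?case using partial_sum_pos[of \<omega>] by (auto simp: point_R_def)
qed

section \<open>Joint law of the attachment points given the partial sums\<close>

text \<open>The assumed conditional law, integrated over an event \<open>G\<close> of
  \<open>F\<close> by the defining property of the conditional expectation.\<close>

lemma attach_rectangle:
  assumes G: "G \<in> sets F" and A: "\<And>k. k \<in> {1..m * n} \<Longrightarrow> A k \<in> sets borel"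
  shows "emeasure M {\<omega> \<in> G. \<forall>k\<in>{1..m * n}. l k \<omega> \<in> A k} =
    (\<integral>\<^sup>+\<omega>. indicator G \<omega> * (\<Prod>k=1..m * n. attach_mass (R k \<omega>) (A k)) \<partial>M)"
proof -
  define E where "E = {\<omega> \<in> space M. \<forall>k\<in>{1..m * n}. l k \<omega> \<in> A k}"
  define q where "q = (\<lambda>\<omega>. \<Prod>k=1..m * n. enn2real (attach_mass (R k \<omega>) (A k)))"
  have GM[measurable]: "G \<in> sets M" using G subalg by (auto simp: subalgebra_def)
  have E[measurable]: "E \<in> sets M"
    unfolding E_def using A measurable_l by (intro sets.sets_Collect_finite_All) auto
  have mass[measurable]: "(\<lambda>\<omega>. attach_mass (R k \<omega>) (A k)) \<in> borel_measurable M"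
    if k: "k \<in> {1..m * n}" for k
  proof (rule measurable_from_subalg[OF subalg])
    have "space F \<times> A k \<in> sets (F \<Otimes>\<^sub>M borel)" using A[OF k] by auto
    then have "(\<lambda>\<omega>. attach_mass (R k \<omega>) (Pair \<omega> -` (space F \<times> A k))) \<in> borel_measurable F"
      using k by (intro attach_mass_section_measurable R_measurable_F) auto
    moreover have "Pair \<omega> -` (space F \<times> A k) = A k" if "\<omega> \<in> space F" for \<omega>
      using that by auto
    ultimately show "(\<lambda>\<omega>. attach_mass (R k \<omega>) (A k)) \<in> borel_measurable F"
      by (simp cong: measurable_cong)
  qed
  have q_meas[measurable]: "q \<in> borel_measurable M"
    unfolding q_def by (intro borel_measurable_prod) simp
  have q: "0 \<le> q \<omega>" "q \<omega> \<le> 1" for \<omega>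
    unfolding q_def by (auto intro!: prod_nonneg prod_le_1 enn2real_attach_mass_le_1)
  have ae: "AE \<omega> in M. real_cond_exp M F (indicator E) \<omega> = q \<omega>"
    using conditional_law_l[of A] A unfolding E_def q_def
    by (auto simp: set_integral_attach_density)
  have int: "integrable M (\<lambda>\<omega>. indicator G \<omega> * q \<omega>)"
    using q by (intro integrable_const_bound[of _ 1]) (auto split: split_indicator)
  have "{\<omega> \<in> G. \<forall>k\<in>{1..m * n}. l k \<omega> \<in> A k} = G \<inter> E"
    using sets.sets_into_space[OF GM] by (auto simp: E_def)
  then have "emeasure M {\<omega> \<in> G. \<forall>k\<in>{1..m * n}. l k \<omega> \<in> A k} = ennreal (measure M (G \<inter> E))"
    by (simp add: emeasure_eq_measure)
  also have "measure M (G \<inter> E) = (\<integral>\<omega>\<in>G. indicator E \<omega> \<partial>M)"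
    unfolding set_lebesgue_integral_def by (simp add: indicator_inter_arith[symmetric])
  also have "\<dots> = (\<integral>\<omega>\<in>G. real_cond_exp M F (indicator E) \<omega> \<partial>M)"
    by (rule real_cond_exp_intA[OF _ G]) (simp add: integrable_real_indicator emeasure_eq_measure)
  also have "\<dots> = (\<integral>\<omega>. indicator G \<omega> * q \<omega> \<partial>M)"
    unfolding set_lebesgue_integral_def using ae by (intro integral_cong_AE) auto
  also have "ennreal \<dots> = (\<integral>\<^sup>+\<omega>. ennreal (indicator G \<omega> * q \<omega>) \<partial>M)"
    using q by (intro nn_integral_eq_integral[OF int, symmetric]) auto
  also have "\<dots> = (\<integral>\<^sup>+\<omega>. indicator G \<omega> * (\<Prod>k=1..m * n. attach_mass (R k \<omega>) (A k)) \<partial>M)"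
    unfolding q_def
    by (intro nn_integral_cong)
      (auto simp: prod_ennreal[symmetric] ennreal_enn2real_attach_mass split: split_indicator)
  finally show ?thesis .
qed

text \<open>
  The sides of a rectangle may depend on the partial sums: they are replaced one at a time,
  each step being an instance of \<open>emeasure_section_eq\<close>.
\<close>

lemma attach_joint_law:
  assumes "G \<in> sets F" and "\<And>k. k \<in> {1..m * n} \<Longrightarrow> B k \<in> sets (F \<Otimes>\<^sub>M borel)"
  shows "emeasure M {\<omega> \<in> G. \<forall>k\<in>{1..m * n}. (\<omega>, l k \<omega>) \<in> B k} =
    (\<integral>\<^sup>+\<omega>. indicator G \<omega> * (\<Prod>k=1..m * n. attach_mass (R k \<omega>) (Pair \<omega> -` B k)) \<partial>M)"
proof -
  \<comment> \<open>Induction on the set \<open>S\<close> of indices whose side may be random; every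
    other side has the form \<open>space F \<times> A\<close>. \<open>G\<close> and \<open>B\<close>
    are generalized because each step calls the induction hypothesis with a new event and with side
    \<open>j\<close> replaced.\<close>
  have "emeasure M {\<omega> \<in> G. \<forall>k\<in>{1..m * n}. (\<omega>, l k \<omega>) \<in> B k} =
      (\<integral>\<^sup>+\<omega>. indicator G \<omega> * (\<Prod>k=1..m * n. attach_mass (R k \<omega>) (Pair \<omega> -` B k)) \<partial>M)"
    if "finite S" "S \<subseteq> {1..m * n}" "G \<in> sets F"
      "\<And>k. k \<in> {1..m * n} \<Longrightarrow> B k \<in> sets (F \<Otimes>\<^sub>M borel)"
      "\<And>k. k \<in> {1..m * n} - S \<Longrightarrow> \<exists>A\<in>sets borel. B k = space F \<times> A"
    for S G B
    using that
  proof (induction S arbitrary: G B rule: finite_induct)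
    case empty
    then obtain A where A: "\<And>k. k \<in> {1..m * n} \<Longrightarrow> A k \<in> sets borel \<and> B k = space F \<times> A k"
      by (metis Diff_empty)
    have sec: "Pair \<omega> -` B k = A k" if "\<omega> \<in> space M" "k \<in> {1..m * n}" for \<omega> k
      using that A by (auto simp: space_F)
    have G: "G \<subseteq> space M" using empty.prems(2) sets.sets_into_space space_F by blast
    have "{\<omega> \<in> G. \<forall>k\<in>{1..m * n}. (\<omega>, l k \<omega>) \<in> B k} = {\<omega> \<in> G. \<forall>k\<in>{1..m * n}. l k \<omega> \<in> A k}"
      using G A by (auto simp: space_F)
    also have "emeasure M \<dots> = (\<integral>\<^sup>+\<omega>. indicator G \<omega> * (\<Prod>k=1..m * n. attach_mass (R k \<omega>) (A k)) \<partial>M)"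
      using A by (intro attach_rectangle empty.prems(2)) auto
    also have "\<dots> = (\<integral>\<^sup>+\<omega>. indicator G \<omega> * (\<Prod>k=1..m * n. attach_mass (R k \<omega>) (Pair \<omega> -` B k)) \<partial>M)"
      by (intro nn_integral_cong) (simp add: sec)
    finally show ?case .
  next
    case (insert j S)
    have j: "j \<in> {1..m * n}" using insert.prems(1) by simp
    define I where "I = {1..m * n} - {j}"
    have I: "{1..m * n} = Set.insert j I" "j \<notin> I" "finite I" using j by (auto simp: I_def)
    have Bm[measurable]: "B k \<in> sets (F \<Otimes>\<^sub>M borel)" if "k \<in> {1..m * n}" for k
      using insert.prems(3) that .
    \<comment> \<open>\<open>H\<close> collects the conditions on the points other than
      \<open>l j\<close>, and \<open>q\<close> is their conditional probability. Hence
      \<open>g\<close> should be the density of the pair of \<omega> and \<open>l j\<close> on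
      \<open>H\<close>.\<close>
    define H where "H = {\<omega> \<in> space M. \<forall>k\<in>I. (\<omega>, l k \<omega>) \<in> B k}"
    define q where "q = (\<lambda>\<omega>. \<Prod>k\<in>I. attach_mass (R k \<omega>) (Pair \<omega> -` B k))"
    define g where "g = (\<lambda>(\<omega>, x). q \<omega> * ennreal (attach_density (R j \<omega>) x))"
    have id[measurable]: "(\<lambda>\<omega>. \<omega>) \<in> M \<rightarrow>\<^sub>M F"
      using subalg by (auto simp: measurable_def subalgebra_def)
    have H: "H \<in> sets M"
      unfolding H_def
    proof (intro sets.sets_Collect_finite_All I(3))
      fix k assume "k \<in> I"
      then have k: "k \<in> {1..m * n}" by (auto simp: I_def)
      have [measurable]: "l k \<in> borel_measurable M" by (rule measurable_l[OF k])
      have "(\<lambda>\<omega>. (\<omega>, l k \<omega>)) \<in> M \<rightarrow>\<^sub>M F \<Otimes>\<^sub>M borel" by measurable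
      from measurable_sets[OF this Bm[OF k]]
      show "{\<omega> \<in> space M. (\<omega>, l k \<omega>) \<in> B k} \<in> sets M"
        by (simp add: vimage_def Int_def conj_commute)
    qed
    have q[measurable]: "q \<in> borel_measurable F"
      unfolding q_def using Bm
      by (intro borel_measurable_prod_ennreal attach_mass_section_measurable R_measurable_F)
        (auto simp: I_def)
    have Rj[measurable]: "R j \<in> borel_measurable F" using j by (intro R_measurable_F) simp
    have g: "g \<in> borel_measurable (F \<Otimes>\<^sub>M borel)"
      unfolding g_def by measurable
    have gint: "(\<integral>\<^sup>+x. indicator (C \<inter> G' \<times> UNIV) (\<omega>, x) * g (\<omega>, x) \<partial>lborel) =
        indicator G' \<omega> * (q \<omega> * attach_mass (R j \<omega>) (Pair \<omega> -` C))"
      if C: "C \<in> sets (F \<Otimes>\<^sub>M borel)" and \<omega>: "\<omega> \<in> space M" for C G' \<omega>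
    proof -
      have [measurable]: "Pair \<omega> -` C \<in> sets borel" using sets_Pair1[OF C] .
      have "(\<integral>\<^sup>+x. indicator (C \<inter> G' \<times> UNIV) (\<omega>, x) * g (\<omega>, x) \<partial>lborel) =
          (\<integral>\<^sup>+x. indicator G' \<omega> * q \<omega> *
            (indicator (Pair \<omega> -` C) x * ennreal (attach_density (R j \<omega>) x)) \<partial>lborel)"
        by (intro nn_integral_cong) (auto simp: g_def split: split_indicator)
      also have "\<dots> = indicator G' \<omega> * q \<omega> * attach_mass (R j \<omega>) (Pair \<omega> -` C)"
        unfolding attach_mass_def by (intro nn_integral_cmult) simp
      finally show ?thesis by (simp add: mult.assoc)
    qed
    have GF: "G \<in> sets F" by (rule insert.prems(2))
    \<comment> \<open>The event \<open>G\<close> is absorbed into the section set as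
      \<open>G \<times> UNIV\<close>.\<close>
    have "{\<omega> \<in> G. \<forall>k\<in>{1..m * n}. (\<omega>, l k \<omega>) \<in> B k} = {\<omega> \<in> H. (\<omega>, l j \<omega>) \<in> B j \<inter> G \<times> UNIV}"
      using sets.sets_into_space[OF GF] unfolding I(1) H_def by (auto simp: space_F)
    also have "emeasure M \<dots> =
        (\<integral>\<^sup>+\<omega>. (\<integral>\<^sup>+x. indicator (B j \<inter> G \<times> UNIV) (\<omega>, x) * g (\<omega>, x) \<partial>lborel) \<partial>M)"
    proof (rule emeasure_section_eq[OF subalg H measurable_l[OF j] g])
      show "B j \<inter> G \<times> UNIV \<in> sets (F \<Otimes>\<^sub>M borel)"
        using Bm[OF j] GF by auto
    next
      fix G' A assume G': "G' \<in> sets F" and A: "A \<in> sets (borel :: real measure)"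
      \<comment> \<open>With side \<open>j\<close> fixed, only sides with index in \<open>S\<close>
        remain random, so the induction hypothesis yields the rectangle identity.\<close>
      let ?B = "B(j := space F \<times> A)"
      have sec: "?B k = B k" if "k \<in> I" for k using that by (auto simp: I_def)
      have sets_eq: "{\<omega> \<in> G' \<inter> H. l j \<omega> \<in> A} = {\<omega> \<in> G'. \<forall>k\<in>{1..m * n}. (\<omega>, l k \<omega>) \<in> ?B k}"
        using sets.sets_into_space[OF G'] sec unfolding I(1) H_def by (auto simp: space_F)
      have "emeasure M {\<omega> \<in> G' \<inter> H. l j \<omega> \<in> A} =
          (\<integral>\<^sup>+\<omega>. indicator G' \<omega> * (\<Prod>k=1..m * n. attach_mass (R k \<omega>) (Pair \<omega> -` ?B k)) \<partial>M)"
        unfolding sets_eq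
      proof (rule insert.IH)
        show "S \<subseteq> {1..m * n}" "G' \<in> sets F" using insert.prems(1) G' by auto
        show "?B k \<in> sets (F \<Otimes>\<^sub>M borel)" if "k \<in> {1..m * n}" for k
          using Bm[OF that] A by auto
        show "\<exists>A\<in>sets borel. ?B k = space F \<times> A" if "k \<in> {1..m * n} - S" for k
          by (cases "k = j") (use insert.prems(4)[of k] that A in \<open>force+\<close>)
      qed
      also have "\<dots> = (\<integral>\<^sup>+\<omega>. (\<integral>\<^sup>+x. indicator (G' \<times> A) (\<omega>, x) * g (\<omega>, x) \<partial>lborel) \<partial>M)"
      proof (rule nn_integral_cong)
        fix \<omega> assume \<omega>: "\<omega> \<in> space M"
        have "space F \<times> A \<inter> G' \<times> UNIV = G' \<times> A"
          using sets.sets_into_space[OF G'] by auto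
        moreover have FA: "space F \<times> A \<in> sets (F \<Otimes>\<^sub>M borel)" using A by auto
        ultimately have "(\<integral>\<^sup>+x. indicator (G' \<times> A) (\<omega>, x) * g (\<omega>, x) \<partial>lborel) =
            indicator G' \<omega> * (q \<omega> * attach_mass (R j \<omega>) (Pair \<omega> -` (space F \<times> A)))"
          using gint[OF FA \<omega>, of G'] by (simp only:)
        also have "q \<omega> * attach_mass (R j \<omega>) (Pair \<omega> -` (space F \<times> A)) =
            (\<Prod>k=1..m * n. attach_mass (R k \<omega>) (Pair \<omega> -` ?B k))"
          unfolding I(1) q_def prod.insert[OF I(3,2)] using sec by (simp add: mult.commute)
        finally show "indicator G' \<omega> * (\<Prod>k=1..m * n. attach_mass (R k \<omega>) (Pair \<omega> -` ?B k)) =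
            (\<integral>\<^sup>+x. indicator (G' \<times> A) (\<omega>, x) * g (\<omega>, x) \<partial>lborel)" by simp
      qed
      finally show "emeasure M {\<omega> \<in> G' \<inter> H. l j \<omega> \<in> A} =
          (\<integral>\<^sup>+\<omega>. (\<integral>\<^sup>+x. indicator (G' \<times> A) (\<omega>, x) * g (\<omega>, x) \<partial>lborel) \<partial>M)" .
    qed
    also have "\<dots> = (\<integral>\<^sup>+\<omega>. indicator G \<omega> * (\<Prod>k=1..m * n. attach_mass (R k \<omega>) (Pair \<omega> -` B k)) \<partial>M)"
    proof (rule nn_integral_cong)
      fix \<omega> assume "\<omega> \<in> space M"
      then show "(\<integral>\<^sup>+x. indicator (B j \<inter> G \<times> UNIV) (\<omega>, x) * g (\<omega>, x) \<partial>lborel) =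
          indicator G \<omega> * (\<Prod>k=1..m * n. attach_mass (R k \<omega>) (Pair \<omega> -` B k))"
        using gint[OF Bm[OF j], of \<omega> G] unfolding I(1) q_def prod.insert[OF I(3,2)]
        by (simp only: mult.commute)
    qed
    finally show ?case .
  qed
  from this[of "{1..m * n}" G B] assms show ?thesis by simp
qed

section \<open>Loop events and their conditional probabilities\<close>

text \<open>A subset of the product, so that it can serve as a side in
  \<open>attach_joint_law\<close>. Its section at \<omega> is the union of the vertex intervals that
  contain \<open>R k \<omega>\<close>.\<close>

definition loop_region :: "nat \<Rightarrow> ('a \<times> real) set" where
  "loop_region k = {(\<omega>, x) \<in> space F \<times> UNIV. \<exists>j\<in>{1..n}.
     R k \<omega> \<in> vertex_interval m n w j \<omega> \<and> x \<in> vertex_interval m n w j \<omega>}"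

definition loop_event :: "nat \<Rightarrow> 'a set" where
  "loop_event k = {\<omega> \<in> space M. (\<omega>, l k \<omega>) \<in> loop_region k}"

definition loop_prob :: "nat \<Rightarrow> 'a \<Rightarrow> real" where
  "loop_prob k \<omega> = enn2real (attach_mass (R k \<omega>) (Pair \<omega> -` loop_region k))"

lemma loop_region_measurable:
  assumes "k \<in> {1..m * n}"
  shows "loop_region k \<in> sets (F \<Otimes>\<^sub>M borel)"
proof -
  have [measurable]: "R k \<in> borel_measurable F" using assms by (intro R_measurable_F) simp
  have "{z \<in> space (F \<Otimes>\<^sub>M borel). R (m * (j - 1)) (fst z) < R k (fst z) \<and>
      R k (fst z) \<le> R (m * j) (fst z) \<and>
      R (m * (j - 1)) (fst z) < snd z \<and> snd z \<le> R (m * j) (fst z)} \<in> sets (F \<Otimes>\<^sub>M borel)"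
    if "j \<in> {1..n}" for j
  proof -
    have "m * j \<le> m * n" "m * (j - 1) \<le> m * n" using that by (auto intro!: mult_le_mono)
    then have [measurable]: "R (m * (j - 1)) \<in> borel_measurable F" "R (m * j) \<in> borel_measurable F"
      by (auto intro!: R_measurable_F le_SucI simp del: mult_le_cancel1)
    show ?thesis by measurable
  qed
  then have "(\<Union>j\<in>{1..n}. {z \<in> space (F \<Otimes>\<^sub>M borel). R (m * (j - 1)) (fst z) < R k (fst z) \<and>
      R k (fst z) \<le> R (m * j) (fst z) \<and>
      R (m * (j - 1)) (fst z) < snd z \<and> snd z \<le> R (m * j) (fst z)}) \<in> sets (F \<Otimes>\<^sub>M borel)"
    by (intro sets.finite_UN) auto
  also have "(\<Union>j\<in>{1..n}. {z \<in> space (F \<Otimes>\<^sub>M borel). R (m * (j - 1)) (fst z) < R k (fst z) \<and>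
      R k (fst z) \<le> R (m * j) (fst z) \<and>
      R (m * (j - 1)) (fst z) < snd z \<and> snd z \<le> R (m * j) (fst z)}) = loop_region k"
    by (auto simp: loop_region_def vertex_interval_def space_pair_measure)
  finally show ?thesis .
qed

lemma loop_event_measurable:
  assumes "k \<in> {1..m * n}"
  shows "loop_event k \<in> sets M"
proof -
  have [measurable]: "(\<lambda>\<omega>. \<omega>) \<in> M \<rightarrow>\<^sub>M F" "l k \<in> borel_measurable M"
    using subalg measurable_l[OF assms] by (auto simp: measurable_def subalgebra_def)
  have "(\<lambda>\<omega>. (\<omega>, l k \<omega>)) \<in> M \<rightarrow>\<^sub>M F \<Otimes>\<^sub>M borel" by measurable
  from measurable_sets[OF this loop_region_measurable[OF assms]] show ?thesis
    by (simp add: loop_event_def vimage_def Int_def conj_commute)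
qed

lemma loop_prob_measurable: "k \<in> {1..m * n} \<Longrightarrow> loop_prob k \<in> borel_measurable F"
  unfolding loop_prob_def[abs_def]
  by (intro borel_measurable_enn2real
      attach_mass_section_measurable R_measurable_F loop_region_measurable) auto

lemma loop_prob_bounds: "0 \<le> loop_prob k \<omega>" "loop_prob k \<omega> \<le> 1"
  by (simp_all add: loop_prob_def enn2real_attach_mass_le_1)

lemma num_loops_eq:
  assumes "\<omega> \<in> space M"
  shows "num_loops m n w l \<omega> = (\<Sum>k=1..m * n. indicator (loop_event k) \<omega>)"
proof -
  have "{k \<in> {1..m * n}. \<exists>j. edge_joins m n w l \<omega> k j j} = {k \<in> {1..m * n}. \<omega> \<in> loop_event k}"
    using assms
    by (auto simp: edge_joins_def loop_event_def loop_region_def space_F)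
  then show ?thesis
    by (simp add: num_loops_def indicator_def sum.If_cases Int_def)
qed

section \<open>Conditional independence and conditional moments of the number of loops\<close>

text \<open>Conditional independence of the loop events: each loop region is determined by the
  partial sums, so \<open>attach_joint_law\<close> factorizes the probability. Sets \<open>T\<close>
  of one or two indices give the first and second moments.\<close>

lemma cond_exp_loop_events:
  assumes T: "T \<subseteq> {1..m * n}"
  shows "AE \<omega> in M. real_cond_exp M F (\<lambda>\<omega>. \<Prod>k\<in>T. indicator (loop_event k) \<omega>) \<omega> =
    (\<Prod>k\<in>T. loop_prob k \<omega>)"
proof (rule real_cond_exp_charact)
  have fin: "finite T" using T finite_subset by blast
  have E[measurable]: "loop_event k \<in> sets M" if "k \<in> T" for k
    using that T loop_event_measurable by blast
  show q_meas: "(\<lambda>\<omega>. \<Prod>k\<in>T. loop_prob k \<omega>) \<in> borel_measurable F"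
    using T by (intro borel_measurable_prod loop_prob_measurable) auto
  have q_meas'[measurable]: "(\<lambda>\<omega>. \<Prod>k\<in>T. loop_prob k \<omega>) \<in> borel_measurable M"
    using q_meas measurable_from_subalg[OF subalg] by blast
  have q: "0 \<le> (\<Prod>k\<in>T. loop_prob k \<omega>)" "(\<Prod>k\<in>T. loop_prob k \<omega>) \<le> 1" for \<omega>
    by (auto intro!: prod_nonneg prod_le_1 loop_prob_bounds)
  show "integrable M (\<lambda>\<omega>. \<Prod>k\<in>T. loop_prob k \<omega>)"
    using q by (intro integrable_const_bound[of _ 1]) auto
  have X: "0 \<le> (\<Prod>k\<in>T. indicator (loop_event k) \<omega> :: real)"
    "(\<Prod>k\<in>T. indicator (loop_event k) \<omega> :: real) \<le> 1" for \<omega>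
    by (auto intro!: prod_nonneg prod_le_1)
  have X_meas: "(\<lambda>\<omega>. \<Prod>k\<in>T. indicator (loop_event k) \<omega> :: real) \<in> borel_measurable M"
    by (intro borel_measurable_prod borel_measurable_indicator E)
  then show "integrable M (\<lambda>\<omega>. \<Prod>k\<in>T. indicator (loop_event k) \<omega> :: real)"
    using X by (intro integrable_const_bound[of _ 1]) auto
  fix G assume G: "G \<in> sets F"
  then have GM[measurable]: "G \<in> sets M" using subalg by (auto simp: subalgebra_def)
  have Gsp: "G \<subseteq> space M" using sets.sets_into_space[OF GM] .
  \<comment> \<open>A full side leaves \<open>l k\<close> unconstrained. Its mass is 1 as soon as
    \<open>0 < R k \<omega>\<close>, which holds almost everywhere.\<close>
  let ?B = "\<lambda>k. if k \<in> T then loop_region k else space F \<times> UNIV"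
  define E where "E = {\<omega> \<in> G. \<forall>k\<in>{1..m * n}. (\<omega>, l k \<omega>) \<in> ?B k}"
  have E_alt: "E = {\<omega> \<in> G. \<forall>k\<in>T. \<omega> \<in> loop_event k}"
    using Gsp T by (auto simp: E_def loop_event_def space_F)
  have "E = G \<inter> {\<omega> \<in> space M. \<forall>k\<in>T. \<omega> \<in> loop_event k}" using Gsp by (auto simp: E_alt)
  also have "\<dots> \<in> sets M"
    using E by (intro sets.Int GM sets.sets_Collect_finite_All fin) (auto simp: Int_absorb1)
  finally have EM[measurable]: "E \<in> sets M" .
  have indE: "indicator E \<omega> = indicator G \<omega> * (\<Prod>k\<in>T. indicator (loop_event k) \<omega> :: real)" for \<omega>
    using fin by (auto simp: E_alt indicator_def)
  have int: "integrable M (\<lambda>\<omega>. indicator G \<omega> * (\<Prod>k\<in>T. loop_prob k \<omega>))"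
    using q by (intro integrable_const_bound[of _ 1]) (auto split: split_indicator)
  have "emeasure M E = (\<integral>\<^sup>+\<omega>. indicator G \<omega> *
      (\<Prod>k=1..m * n. attach_mass (R k \<omega>) (Pair \<omega> -` ?B k)) \<partial>M)"
    unfolding E_def using loop_region_measurable by (intro attach_joint_law G) auto
  also have "\<dots> = (\<integral>\<^sup>+\<omega>. ennreal (indicator G \<omega> * (\<Prod>k\<in>T. loop_prob k \<omega>)) \<partial>M)"
  proof (rule nn_integral_cong_AE)
    show "AE \<omega> in M. indicator G \<omega> * (\<Prod>k=1..m * n. attach_mass (R k \<omega>) (Pair \<omega> -` ?B k)) =
        ennreal (indicator G \<omega> * (\<Prod>k\<in>T. loop_prob k \<omega>))"
      using AE_R_pos AE_space
    proof eventually_elim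
      case (elim \<omega>)
      have "(\<Prod>k=1..m * n. attach_mass (R k \<omega>) (Pair \<omega> -` ?B k)) =
          (\<Prod>k\<in>T. attach_mass (R k \<omega>) (Pair \<omega> -` ?B k))"
      proof (rule prod.mono_neutral_right)
        show "\<forall>k\<in>{1..m * n} - T. attach_mass (R k \<omega>) (Pair \<omega> -` ?B k) = 1"
        proof
          fix k assume k: "k \<in> {1..m * n} - T"
          then have "Pair \<omega> -` ?B k = UNIV" using elim(2) by (auto simp: space_F)
          then show "attach_mass (R k \<omega>) (Pair \<omega> -` ?B k) = 1"
            using attach_mass_UNIV k elim(1) by simp
        qed
      qed (use T in auto)
      also have "\<dots> = (\<Prod>k\<in>T. ennreal (loop_prob k \<omega>))"
        by (intro prod.cong) (auto simp: loop_prob_def ennreal_enn2real_attach_mass)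
      also have "\<dots> = ennreal (\<Prod>k\<in>T. loop_prob k \<omega>)"
        by (intro prod_ennreal loop_prob_bounds)
      finally show ?case by (auto split: split_indicator)
    qed
  qed
  also have "\<dots> = ennreal (\<integral>\<omega>. indicator G \<omega> * (\<Prod>k\<in>T. loop_prob k \<omega>) \<partial>M)"
    using q by (intro nn_integral_eq_integral[OF int]) auto
  finally have "measure M E = (\<integral>\<omega>. indicator G \<omega> * (\<Prod>k\<in>T. loop_prob k \<omega>) \<partial>M)"
    using q by (simp add: emeasure_eq_measure integral_nonneg_AE)
  moreover have "measure M E = (\<integral>\<omega>. indicator E \<omega> \<partial>M)" by simp
  ultimately show "(\<integral>\<omega>\<in>G. (\<Prod>k\<in>T. indicator (loop_event k) \<omega>) \<partial>M) =
      (\<integral>\<omega>\<in>G. (\<Prod>k\<in>T. loop_prob k \<omega>) \<partial>M)"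
    unfolding set_lebesgue_integral_def real_scaleR_def indE by simp
qed

text \<open>A bounded \<open>F\<close>-measurable weight passes through the conditional expectation.
  Such weighted expectations take the place of conditional moments from here on.\<close>

lemma expectation_loop_events:
  assumes T: "T \<subseteq> {1..m * n}" and f[measurable]: "f \<in> borel_measurable F" and "\<And>\<omega>. \<bar>f \<omega>\<bar> \<le> C"
  shows "expectation (\<lambda>\<omega>. f \<omega> * (\<Prod>k\<in>T. indicator (loop_event k) \<omega>)) =
    expectation (\<lambda>\<omega>. f \<omega> * (\<Prod>k\<in>T. loop_prob k \<omega>))"
proof -
  have fM[measurable]: "f \<in> borel_measurable M" by (rule measurable_from_subalg[OF subalg f])
  have X_meas[measurable]: "(\<lambda>\<omega>. \<Prod>k\<in>T. indicator (loop_event k) \<omega> :: real) \<in> borel_measurable M"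
    using T by (intro borel_measurable_prod borel_measurable_indicator loop_event_measurable) auto
  have q_meas[measurable]: "(\<lambda>\<omega>. \<Prod>k\<in>T. loop_prob k \<omega>) \<in> borel_measurable M"
    using T by (intro borel_measurable_prod measurable_from_subalg[OF subalg] loop_prob_measurable) auto
  have int: "integrable M (\<lambda>\<omega>. f \<omega> * (\<Prod>k\<in>T. indicator (loop_event k) \<omega>))"
  proof (rule integrable_const_bound[of _ C])
    have "\<bar>f \<omega> * (\<Prod>k\<in>T. indicator (loop_event k) \<omega>)\<bar> \<le> C * 1" for \<omega>
      unfolding abs_mult using assms(3)[of \<omega>]
      by (intro mult_mono) (auto simp: abs_prod intro!: prod_le_1 prod_nonneg)
    then show "AE \<omega> in M. norm (f \<omega> * (\<Prod>k\<in>T. indicator (loop_event k) \<omega>)) \<le> C" by simp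
  qed simp
  have "expectation (\<lambda>\<omega>. f \<omega> * (\<Prod>k\<in>T. indicator (loop_event k) \<omega>)) =
      expectation (\<lambda>\<omega>. f \<omega> * real_cond_exp M F (\<lambda>\<omega>. \<Prod>k\<in>T. indicator (loop_event k) \<omega>) \<omega>)"
    by (rule real_cond_exp_intg(2)[symmetric, OF int f X_meas])
  also have "\<dots> = expectation (\<lambda>\<omega>. f \<omega> * (\<Prod>k\<in>T. loop_prob k \<omega>))"
    using cond_exp_loop_events[OF T] by (intro integral_cong_AE) auto
  finally show ?thesis .
qed

text \<open>An explicit version of the conditional mean, with which \<open>cond_num_loops\<close>
  agrees almost everywhere.\<close>

definition loop_mean :: "'a \<Rightarrow> real" where
  "loop_mean \<omega> = (\<Sum>k=1..m * n. loop_prob k \<omega>)"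

lemma loop_mean_measurable: "loop_mean \<in> borel_measurable F"
  unfolding loop_mean_def[abs_def] by (intro borel_measurable_sum loop_prob_measurable)

lemma num_loops_measurable: "num_loops m n w l \<in> borel_measurable M"
proof -
  have "(\<lambda>\<omega>. \<Sum>k=1..m * n. indicator (loop_event k) \<omega> :: real) \<in> borel_measurable M"
    by (intro borel_measurable_sum borel_measurable_indicator loop_event_measurable)
  then show ?thesis by (simp add: num_loops_eq cong: measurable_cong)
qed

lemma loop_mean_bounds: "0 \<le> loop_mean \<omega>" "loop_mean \<omega> \<le> m * n"
  unfolding loop_mean_def
  using sum_bounded_above[of "{1..m * n}" "\<lambda>k. loop_prob k \<omega>" 1]
  by (auto intro!: sum_nonneg loop_prob_bounds)

lemma num_loops_bounds: "0 \<le> num_loops m n w l \<omega>" "num_loops m n w l \<omega> \<le> m * n"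
proof -
  have "card {k \<in> {1..m * n}. \<exists>j. edge_joins m n w l \<omega> k j j} \<le> card {1..m * n}"
    by (intro card_mono) auto
  then show "0 \<le> num_loops m n w l \<omega>" "num_loops m n w l \<omega> \<le> m * n"
    unfolding num_loops_def of_nat_mult[symmetric] of_nat_le_iff by simp_all
qed

text \<open>Linearity and the case of a single index. Indicator weights identify the conditional
  mean; the weight \<open>f \<omega> * loop_mean \<omega>\<close> gives the cross term in
  Chebyshev's inequality.\<close>

lemma expectation_num_loops:
  assumes f[measurable]: "f \<in> borel_measurable F" and C: "\<And>\<omega>. \<bar>f \<omega>\<bar> \<le> C"
  shows "expectation (\<lambda>\<omega>. f \<omega> * num_loops m n w l \<omega>) = expectation (\<lambda>\<omega>. f \<omega> * loop_mean \<omega>)"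
proof -
  have fM[measurable]: "f \<in> borel_measurable M" by (rule measurable_from_subalg[OF subalg f])
  have [measurable]: "loop_prob k \<in> borel_measurable M" "loop_event k \<in> sets M"
    if "k \<in> {1..m * n}" for k
    using that loop_event_measurable measurable_from_subalg[OF subalg loop_prob_measurable] by auto
  have 1: "integrable M (\<lambda>\<omega>. f \<omega> * indicator (loop_event k) \<omega>)" if "k \<in> {1..m * n}" for k
    using C that by (intro integrable_const_bound[of _ C]) (auto simp: abs_mult split: split_indicator
        intro: order_trans[OF abs_ge_zero C])
  have 2: "integrable M (\<lambda>\<omega>. f \<omega> * loop_prob k \<omega>)" if "k \<in> {1..m * n}" for k
  proof (rule integrable_const_bound[of _ "C * 1"])
    show "AE \<omega> in M. norm (f \<omega> * loop_prob k \<omega>) \<le> C * 1"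
      using C loop_prob_bounds unfolding real_norm_def abs_mult
      by (intro AE_I2 mult_mono order_trans[OF abs_ge_zero C]) auto
  qed (use that in measurable)
  have "expectation (\<lambda>\<omega>. f \<omega> * num_loops m n w l \<omega>) =
      expectation (\<lambda>\<omega>. \<Sum>k=1..m * n. f \<omega> * indicator (loop_event k) \<omega>)"
    by (intro Bochner_Integration.integral_cong) (auto simp: num_loops_eq sum_distrib_left)
  also have "\<dots> = (\<Sum>k=1..m * n. expectation (\<lambda>\<omega>. f \<omega> * indicator (loop_event k) \<omega>))"
    by (intro Bochner_Integration.integral_sum 1)
  also have "\<dots> = (\<Sum>k=1..m * n. expectation (\<lambda>\<omega>. f \<omega> * loop_prob k \<omega>))"
  proof (rule sum.cong[OF refl])
    fix k assume "k \<in> {1..m * n}"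
    then show "expectation (\<lambda>\<omega>. f \<omega> * indicator (loop_event k) \<omega>) =
        expectation (\<lambda>\<omega>. f \<omega> * loop_prob k \<omega>)"
      using expectation_loop_events[OF _ f C, of "{k}"] by simp
  qed
  also have "\<dots> = expectation (\<lambda>\<omega>. \<Sum>k=1..m * n. f \<omega> * loop_prob k \<omega>)"
    by (intro Bochner_Integration.integral_sum[symmetric] 2)
  finally show ?thesis by (simp add: loop_mean_def sum_distrib_left)
qed

lemma cond_num_loops_eq: "AE \<omega> in M. cond_num_loops m n M w l \<omega> = loop_mean \<omega>"
  unfolding cond_num_loops_def
proof (rule real_cond_exp_charact)
  show "loop_mean \<in> borel_measurable F" by (rule loop_mean_measurable)
  show "integrable M loop_mean" "integrable M (num_loops m n w l)"
    using loop_mean_bounds num_loops_bounds num_loops_measurable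
      measurable_from_subalg[OF subalg loop_mean_measurable]
    by (auto intro!: integrable_const_bound[of _ "m * n"])
  fix G assume G: "G \<in> sets F"
  show "(\<integral>\<omega>\<in>G. num_loops m n w l \<omega> \<partial>M) = (\<integral>\<omega>\<in>G. loop_mean \<omega> \<partial>M)"
    unfolding set_lebesgue_integral_def real_scaleR_def
    using G by (intro expectation_num_loops[of _ 1]) (auto split: split_indicator)
qed

text \<open>The weighted form of "conditional variance at most conditional mean". The square is
  expanded over pairs of edges: pairs of distinct edges factorize by conditional independence, and
  the diagonal adds at most \<open>loop_mean\<close>.\<close>

lemma expectation_num_loops_sq_le:
  assumes f[measurable]: "f \<in> borel_measurable F" and f0: "\<And>\<omega>. 0 \<le> f \<omega>" and C: "\<And>\<omega>. f \<omega> \<le> C"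
  shows "expectation (\<lambda>\<omega>. f \<omega> * (num_loops m n w l \<omega>)\<^sup>2) \<le>
    expectation (\<lambda>\<omega>. f \<omega> * ((loop_mean \<omega>)\<^sup>2 + loop_mean \<omega>))"
proof -
  let ?I = "{1..m * n} \<times> {1..m * n}"
  have fM[measurable]: "f \<in> borel_measurable M" by (rule measurable_from_subalg[OF subalg f])
  have C': "\<bar>f \<omega>\<bar> \<le> C" for \<omega> using f0[of \<omega>] C[of \<omega>] by simp
  have p[measurable]: "loop_prob k \<in> borel_measurable M" and E[measurable]: "loop_event k \<in> sets M"
    if "k \<in> {1..m * n}" for k
    using that loop_event_measurable measurable_from_subalg[OF subalg loop_prob_measurable] by auto
  have LM[measurable]: "loop_mean \<in> borel_measurable M"
    by (rule measurable_from_subalg[OF subalg loop_mean_measurable])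
  have int: "integrable M (\<lambda>\<omega>. f \<omega> * g \<omega>)"
    if g: "g \<in> borel_measurable M" "\<And>\<omega>. 0 \<le> g \<omega>" "\<And>\<omega>. g \<omega> \<le> D" for g D
  proof (rule integrable_const_bound[of _ "C * D"])
    show "AE \<omega> in M. norm (f \<omega> * g \<omega>) \<le> C * D"
      using f0 C g order_trans[OF f0 C] by (intro AE_I2) (auto simp: abs_mult intro!: mult_mono)
  qed (use g(1) in measurable)
  have 1: "integrable M (\<lambda>\<omega>. f \<omega> * (\<Prod>i\<in>{k, j}. indicator (loop_event i) \<omega>))"
    if "(k, j) \<in> ?I" for k j
    using that by (intro int[of _ 1] borel_measurable_prod borel_measurable_indicator loop_event_measurable)
      (auto intro!: prod_nonneg prod_le_1)
  have 2: "integrable M (\<lambda>\<omega>. f \<omega> * (\<Prod>i\<in>{k, j}. loop_prob i \<omega>))" if "(k, j) \<in> ?I" for k j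
    using that by (intro int[of _ 1] borel_measurable_prod p)
      (auto intro!: prod_nonneg prod_le_1 loop_prob_bounds)
  \<comment> \<open>The product over the set \<open>{k, j}\<close> covers both cases: for
    \<open>k = j\<close> the set is a singleton, in agreement with an indicator being its own
    square.\<close>
  have sq: "(num_loops m n w l \<omega>)\<^sup>2 = (\<Sum>(k, j)\<in>?I. \<Prod>i\<in>{k, j}. indicator (loop_event i) \<omega>)"
    if "\<omega> \<in> space M" for \<omega>
    unfolding num_loops_eq[OF that] power2_eq_square sum_product sum.cartesian_product
  proof (intro sum.cong refl, clarify)
    fix k j
    show "indicator (loop_event k) \<omega> * indicator (loop_event j) \<omega> =
        (\<Prod>i\<in>{k, j}. indicator (loop_event i) \<omega> :: real)"
      by (cases "k = j") (auto split: split_indicator)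
  qed
  have le: "(\<Sum>(k, j)\<in>?I. \<Prod>i\<in>{k, j}. loop_prob i \<omega>) \<le> (loop_mean \<omega>)\<^sup>2 + loop_mean \<omega>" for \<omega>
  proof -
    \<comment> \<open>On the diagonal the left term is \<open>loop_prob k \<omega>\<close>; the
      square added on the right is nonnegative and completes the double sum to the square of
      \<open>loop_mean\<close>.\<close>
    have "(\<Sum>(k, j)\<in>?I. \<Prod>i\<in>{k, j}. loop_prob i \<omega>) \<le>
        (\<Sum>(k, j)\<in>?I. loop_prob k \<omega> * loop_prob j \<omega> + (if k = j then loop_prob k \<omega> else 0))"
      by (intro sum_mono) (auto intro!: mult_nonneg_nonneg loop_prob_bounds)
    also have "\<dots> = (loop_mean \<omega>)\<^sup>2 + loop_mean \<omega>"
      unfolding loop_mean_def power2_eq_square sum_product sum.cartesian_product[symmetric]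
      by (simp add: sum.distrib)
    finally show ?thesis .
  qed
  have "expectation (\<lambda>\<omega>. f \<omega> * (num_loops m n w l \<omega>)\<^sup>2) =
      expectation (\<lambda>\<omega>. \<Sum>(k, j)\<in>?I. f \<omega> * (\<Prod>i\<in>{k, j}. indicator (loop_event i) \<omega>))"
    by (intro Bochner_Integration.integral_cong refl)
      (simp add: sq sum_distrib_left case_prod_unfold)
  also have "\<dots> = (\<Sum>(k, j)\<in>?I. expectation (\<lambda>\<omega>. f \<omega> * (\<Prod>i\<in>{k, j}. indicator (loop_event i) \<omega>)))"
    unfolding case_prod_unfold by (intro Bochner_Integration.integral_sum 1) auto
  also have "\<dots> = (\<Sum>(k, j)\<in>?I. expectation (\<lambda>\<omega>. f \<omega> * (\<Prod>i\<in>{k, j}. loop_prob i \<omega>)))"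
    using expectation_loop_events[OF _ f C'] by (intro sum.cong) auto
  also have "\<dots> = expectation (\<lambda>\<omega>. \<Sum>(k, j)\<in>?I. f \<omega> * (\<Prod>i\<in>{k, j}. loop_prob i \<omega>))"
    unfolding case_prod_unfold by (intro Bochner_Integration.integral_sum[symmetric] 2) auto
  also have "\<dots> \<le> expectation (\<lambda>\<omega>. f \<omega> * ((loop_mean \<omega>)\<^sup>2 + loop_mean \<omega>))"
  proof (rule integral_mono)
    show "integrable M (\<lambda>\<omega>. \<Sum>(k, j)\<in>?I. f \<omega> * (\<Prod>i\<in>{k, j}. loop_prob i \<omega>))"
      unfolding case_prod_unfold by (intro Bochner_Integration.integrable_sum 2) auto
    show "integrable M (\<lambda>\<omega>. f \<omega> * ((loop_mean \<omega>)\<^sup>2 + loop_mean \<omega>))"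
      using loop_mean_bounds by (intro int[of _ "(m * n)\<^sup>2 + m * n"])
        (auto intro!: add_mono power_mono)
    show "(\<Sum>(k, j)\<in>?I. f \<omega> * (\<Prod>i\<in>{k, j}. loop_prob i \<omega>)) \<le> f \<omega> * ((loop_mean \<omega>)\<^sup>2 + loop_mean \<omega>)"
      for \<omega>
      using mult_left_mono[OF le f0] by (simp add: sum_distrib_left case_prod_unfold)
  qed
  finally show ?thesis .
qed

section \<open>Conditional Chebyshev inequality\<close>

text \<open>Given the partial sums, the variance is at most the mean \<open>?P\<close>, so the
  deviation probability is at most \<open>1 / (\<epsilon>\<^sup>2 * ?P)\<close>, and
  \<open>?P\<close> is at least \<open>t\<close> on the event. The proof uses one weighted
  expectation instead of conditional probabilities.\<close>

lemma prob_num_loops_deviation: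
  assumes t: "0 < t" and \<epsilon>: "0 < \<epsilon>"
  shows "prob {\<omega> \<in> space M. \<bar>num_loops m n w l \<omega> - loop_mean \<omega>\<bar> \<ge> \<epsilon> * loop_mean \<omega> \<and>
      loop_mean \<omega> \<ge> t} \<le> 1 / (\<epsilon>\<^sup>2 * t)" (is "prob ?S \<le> _")
proof -
  let ?L = "num_loops m n w l" and ?P = loop_mean
  \<comment> \<open>Chebyshev's normalization by the squared mean becomes the weight; the cutoff at
    \<open>t\<close> keeps it bounded and, as \<open>?P\<close> is \<open>F\<close>-measurable, so
    is \<open>f\<close>.\<close>
  define f where "f = (\<lambda>\<omega>. if t \<le> ?P \<omega> then 1 / (?P \<omega>)\<^sup>2 else 0)"
  have PF[measurable]: "?P \<in> borel_measurable F" by (rule loop_mean_measurable)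
  have PM[measurable]: "?P \<in> borel_measurable M" by (rule measurable_from_subalg[OF subalg PF])
  have LM[measurable]: "?L \<in> borel_measurable M" by (rule num_loops_measurable)
  have f: "f \<in> borel_measurable F" unfolding f_def by measurable
  have fM[measurable]: "f \<in> borel_measurable M" by (rule measurable_from_subalg[OF subalg f])
  have f0: "0 \<le> f \<omega>" for \<omega> by (simp add: f_def)
  have fC: "f \<omega> \<le> 1 / t\<^sup>2" for \<omega>
    using t by (auto simp: f_def intro!: divide_left_mono power_mono mult_pos_pos)
  have int: "integrable M (\<lambda>\<omega>. f \<omega> * g \<omega>)"
    if g: "g \<in> borel_measurable M" "\<And>\<omega>. 0 \<le> g \<omega>" "\<And>\<omega>. g \<omega> \<le> D" for g D
  proof (rule integrable_const_bound[of _ "1 / t\<^sup>2 * D"])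
    show "AE \<omega> in M. norm (f \<omega> * g \<omega>) \<le> 1 / t\<^sup>2 * D"
      using f0 fC g unfolding real_norm_def abs_mult by (intro AE_I2 mult_mono) auto
  qed (use g(1) in measurable)
  have b: "0 \<le> ?L \<omega>" "?L \<omega> \<le> m * n" "0 \<le> ?P \<omega>" "?P \<omega> \<le> m * n" for \<omega>
    using num_loops_bounds[of \<omega>] loop_mean_bounds[of \<omega>] by auto
  have i1: "integrable M (\<lambda>\<omega>. f \<omega> * (?L \<omega>)\<^sup>2)"
    by (rule int[of _ "(m * n)\<^sup>2"]) (use b in \<open>auto intro!: power_mono\<close>)
  have i2: "integrable M (\<lambda>\<omega>. f \<omega> * (?P \<omega> * ?L \<omega>))"
    by (rule int[of _ "(m * n) * (m * n)"]) (use b in \<open>auto intro!: mult_mono\<close>)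
  have i3: "integrable M (\<lambda>\<omega>. f \<omega> * (?P \<omega>)\<^sup>2)"
    by (rule int[of _ "(m * n)\<^sup>2"]) (use b in \<open>auto intro!: power_mono\<close>)
  have i4: "integrable M (\<lambda>\<omega>. f \<omega> * ?P \<omega>)"
    by (rule int[of _ "m * n"]) (use b in auto)
  have "expectation (\<lambda>\<omega>. (f \<omega> * ?P \<omega>) * ?L \<omega>) = expectation (\<lambda>\<omega>. (f \<omega> * ?P \<omega>) * ?P \<omega>)"
  proof (rule expectation_num_loops)
    show "(\<lambda>\<omega>. f \<omega> * ?P \<omega>) \<in> borel_measurable F" using f by measurable
    show "\<bar>f \<omega> * ?P \<omega>\<bar> \<le> 1 / t\<^sup>2 * (m * n)" for \<omega>
      unfolding abs_mult using f0[of \<omega>] fC[of \<omega>] b[of \<omega>] by (intro mult_mono) auto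
  qed
  then have cross: "expectation (\<lambda>\<omega>. f \<omega> * (?P \<omega> * ?L \<omega>)) = expectation (\<lambda>\<omega>. f \<omega> * (?P \<omega>)\<^sup>2)"
    by (simp add: mult.assoc power2_eq_square)
  have exp_eq: "(\<lambda>\<omega>. f \<omega> * (?L \<omega> - ?P \<omega>)\<^sup>2) =
      (\<lambda>\<omega>. f \<omega> * (?L \<omega>)\<^sup>2 - 2 * (f \<omega> * (?P \<omega> * ?L \<omega>)) + f \<omega> * (?P \<omega>)\<^sup>2)"
    by (auto simp: power2_eq_square algebra_simps)
  have iD: "integrable M (\<lambda>\<omega>. f \<omega> * (?L \<omega> - ?P \<omega>)\<^sup>2)"
    unfolding exp_eq using i1 i2 i3 by auto
  have "expectation (\<lambda>\<omega>. f \<omega> * (?L \<omega> - ?P \<omega>)\<^sup>2) =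
      expectation (\<lambda>\<omega>. f \<omega> * (?L \<omega>)\<^sup>2) - expectation (\<lambda>\<omega>. f \<omega> * (?P \<omega>)\<^sup>2)"
    unfolding exp_eq using i1 i2 i3 cross by simp
  \<comment> \<open>The squared means cancel, which leaves the weighted mean
    \<open>f \<omega> * ?P \<omega>\<close>: it equals \<open>1 / ?P \<omega>\<close> above the
    cutoff and 0 below it, so it never exceeds \<open>1 / t\<close>.\<close>
  also have "\<dots> \<le> expectation (\<lambda>\<omega>. f \<omega> * ((?P \<omega>)\<^sup>2 + ?P \<omega>)) - expectation (\<lambda>\<omega>. f \<omega> * (?P \<omega>)\<^sup>2)"
    using expectation_num_loops_sq_le[OF f f0 fC] by simp
  also have "\<dots> = expectation (\<lambda>\<omega>. f \<omega> * ?P \<omega>)"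
    using i3 i4 by (simp add: distrib_left)
  also have "\<dots> \<le> expectation (\<lambda>\<omega>. 1 / t)"
  proof (rule integral_mono[OF i4])
    show "f \<omega> * ?P \<omega> \<le> 1 / t" for \<omega>
      using t by (auto simp: f_def power2_eq_square intro!: divide_left_mono mult_pos_pos)
  qed simp
  finally have var: "expectation (\<lambda>\<omega>. f \<omega> * (?L \<omega> - ?P \<omega>)\<^sup>2) \<le> 1 / t" by (simp add: prob_space)
  have "prob ?S = expectation (indicator ?S)" by simp
  also have "\<dots> \<le> expectation (\<lambda>\<omega>. (1 / \<epsilon>\<^sup>2) * (f \<omega> * (?L \<omega> - ?P \<omega>)\<^sup>2))"
  proof (rule integral_mono)
    show "integrable M (indicator ?S :: 'a \<Rightarrow> real)"
      by (intro integrable_real_indicator) (auto simp: emeasure_eq_measure)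
    show "integrable M (\<lambda>\<omega>. (1 / \<epsilon>\<^sup>2) * (f \<omega> * (?L \<omega> - ?P \<omega>)\<^sup>2))" using iD by simp
    show "indicator ?S \<omega> \<le> (1 / \<epsilon>\<^sup>2) * (f \<omega> * (?L \<omega> - ?P \<omega>)\<^sup>2)" for \<omega>
    proof (cases "\<omega> \<in> ?S")
      case True
      then have *: "\<epsilon> * ?P \<omega> \<le> \<bar>?L \<omega> - ?P \<omega>\<bar>" "t \<le> ?P \<omega>" by auto
      then have "0 < ?P \<omega>" using t by simp
      have "(\<epsilon> * ?P \<omega>)\<^sup>2 \<le> (\<bar>?L \<omega> - ?P \<omega>\<bar>)\<^sup>2"
        using * \<epsilon> t by (intro power_mono) auto
      then have "(\<epsilon> * ?P \<omega>)\<^sup>2 \<le> (?L \<omega> - ?P \<omega>)\<^sup>2" by simp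
      then have "1 \<le> (?L \<omega> - ?P \<omega>)\<^sup>2 / (\<epsilon> * ?P \<omega>)\<^sup>2"
        using \<epsilon> \<open>0 < ?P \<omega>\<close> by simp
      then show ?thesis using True * by (simp add: f_def power_mult_distrib)
    qed (simp add: f0)
  qed
  also have "\<dots> = (1 / \<epsilon>\<^sup>2) * expectation (\<lambda>\<omega>. f \<omega> * (?L \<omega> - ?P \<omega>)\<^sup>2)" by simp
  also have "\<dots> \<le> (1 / \<epsilon>\<^sup>2) * (1 / t)" using var by (intro mult_left_mono) auto
  finally show ?thesis by simp
qed

section \<open>Lower bound for the conditional mean by dyadic blocks\<close>

lemma partial_sum_diff:
  assumes "a \<le> b"
  shows "partial_sum w b \<omega> - partial_sum w a \<omega> = (\<Sum>k=Suc a..b. w k \<omega>)"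
proof -
  have "{1..b} = {1..a} \<union> {Suc a..b}" using assms by auto
  then have "partial_sum w b \<omega> = partial_sum w a \<omega> + (\<Sum>k=Suc a..b. w k \<omega>)"
    unfolding partial_sum_def by (simp add: sum.union_disjoint)
  then show ?thesis by simp
qed

lemma partial_sum_mono:
  assumes "\<forall>i\<in>{1..m * n + 1}. 0 < w i \<omega>" "a \<le> b" "b \<le> m * n + 1"
  shows "partial_sum w a \<omega> \<le> partial_sum w b \<omega>"
proof -
  have "0 \<le> (\<Sum>k=Suc a..b. w k \<omega>)"
    using assms by (intro sum_nonneg) (auto intro!: less_imp_le)
  then show ?thesis using partial_sum_diff[OF assms(2), of \<omega>] by simp
qed

text \<open>A vertex interval is made of consecutive pieces between neighbouring points
  \<open>R i\<close>, so the piece that ends in \<open>R k\<close> lies in the interval of the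
  vertex containing \<open>R k\<close>. The bound is the length of this piece times the smallest
  value of the density; the normalization by \<open>W (m * n + 1)\<close> cancels.\<close>

lemma loop_prob_ge:
  assumes pos: "\<forall>i\<in>{1..m * n + 1}. 0 < w i \<omega>" and \<omega>: "\<omega> \<in> space M" and k: "k \<in> {1..m * n}"
  shows "w k \<omega> / (2 * partial_sum w k \<omega>) \<le> loop_prob k \<omega>"
proof -
  define W where "W i = partial_sum w i \<omega>" for i
  \<comment> \<open>The vertex containing \<open>R k\<close>. The shift by one is due to the
    intervals being closed on the right: \<open>k = m * j\<close> still belongs to vertex
    \<open>j\<close>.\<close>
  define j where "j = (k - 1) div m + 1"
  have m: "m > 0" using k by (cases m) auto
  have "m * (j - 1) \<le> k - 1" unfolding j_def by simp
  moreover have "k \<le> m * j"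
  proof -
    have "k - 1 < m * j"
      unfolding j_def using m by (metis add.commute dividend_less_times_div plus_1_eq_Suc mult_Suc_right)
    then show ?thesis using k by simp
  qed
  moreover have "j \<le> n"
  proof -
    have "(k - 1) div m < n" using k m by (intro less_mult_imp_div_less) (auto simp: mult.commute)
    then show ?thesis by (simp add: j_def)
  qed
  moreover have "m * j \<le> m * n" using \<open>j \<le> n\<close> by (rule mult_le_mono2)
  moreover have "j \<ge> 1" by (simp add: j_def)
  ultimately have j: "m * (j - 1) \<le> k - 1" "k \<le> m * j" "m * j \<le> m * n" "j \<in> {1..n}" by auto
  have Wpos: "0 < W i" if "1 \<le> i" "i \<le> m * n + 1" for i
    using partial_sum_pos[OF pos that] by (simp add: W_def)
  have Wmono: "W a \<le> W b" if "a \<le> b" "b \<le> m * n + 1" for a b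
    using partial_sum_mono[OF pos that] by (simp add: W_def)
  have Wdiff: "W k - W (k - 1) = w k \<omega>"
    using partial_sum_diff[of "k - 1" k \<omega>] k by (simp add: W_def)
  have T: "0 < W (m * n + 1)" by (rule Wpos) auto
  have R: "R i \<omega> = W i / W (m * n + 1)" for i by (simp add: point_R_def W_def)
  have Rmono: "R a \<omega> \<le> R b \<omega>" if "a \<le> b" "b \<le> m * n + 1" for a b
    unfolding R using Wmono[OF that] T by (simp add: divide_right_mono)
  have Wk: "0 < W k" using k by (intro Wpos) auto
  then have Rk: "0 < R k \<omega>" unfolding R using T by simp
  have R0: "0 \<le> R (k - 1) \<omega>"
  proof -
    have "R 0 \<omega> = 0" by (simp add: R W_def partial_sum_def)
    moreover have "R 0 \<omega> \<le> R (k - 1) \<omega>" using k by (intro Rmono) auto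
    ultimately show ?thesis by simp
  qed
  have wk: "0 < w k \<omega>" using pos k by simp
  have Rlt: "R (k - 1) \<omega> < R k \<omega>" unfolding R using Wdiff wk T by (simp add: divide_strict_right_mono)
  have R1: "R (m * (j - 1)) \<omega> \<le> R (k - 1) \<omega>" using j k by (intro Rmono) auto
  have R2: "R k \<omega> \<le> R (m * j) \<omega>" by (rule Rmono[OF j(2) trans_le_add1[OF j(3)]])
  have sub: "{R (k - 1) \<omega><..R k \<omega>} \<subseteq> Pair \<omega> -` loop_region k"
    using R1 R2 Rlt \<omega> j(4) by (force simp: loop_region_def vertex_interval_def space_F)
  have "ennreal (w k \<omega> / (2 * W k)) = ennreal (1 / (2 * R k \<omega>)) * emeasure lborel {R (k - 1) \<omega><..R k \<omega>}"
  proof -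
    have "w k \<omega> / (2 * W k) = 1 / (2 * R k \<omega>) * (R k \<omega> - R (k - 1) \<omega>)"
      unfolding R Wdiff[symmetric] using T Wk by (simp add: field_simps)
    then show ?thesis using Rlt Rk by (simp add: ennreal_mult'[symmetric])
  qed
  also have "\<dots> = (\<integral>\<^sup>+x. ennreal (1 / (2 * R k \<omega>)) * indicator {R (k - 1) \<omega><..R k \<omega>} x \<partial>lborel)"
    by (rule nn_integral_cmult_indicator[symmetric]) simp
  also have "\<dots> \<le> attach_mass (R k \<omega>) (Pair \<omega> -` loop_region k)"
    unfolding attach_mass_def
  proof (rule nn_integral_mono)
    fix x
    show "ennreal (1 / (2 * R k \<omega>)) * indicator {R (k - 1) \<omega><..R k \<omega>} x \<le>
        indicator (Pair \<omega> -` loop_region k) x * ennreal (attach_density (R k \<omega>) x)"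
    proof (cases "x \<in> {R (k - 1) \<omega><..R k \<omega>}")
      case True
      then have x: "0 < x" "x \<le> R k \<omega>" "x \<in> Pair \<omega> -` loop_region k" using R0 sub by auto
      \<comment> \<open>The density decreases in \<open>x\<close>, so its minimum on the piece is
        attained at \<open>x = R k \<omega>\<close>.\<close>
      have "sqrt (R k \<omega> * x) \<le> sqrt (R k \<omega> * R k \<omega>)"
        using x Rk by (intro real_sqrt_le_mono mult_left_mono) auto
      then have "sqrt (R k \<omega> * x) \<le> R k \<omega>" using Rk by simp
      then have "1 / (2 * R k \<omega>) \<le> 1 / (2 * sqrt (R k \<omega> * x))"
        using x Rk by (intro divide_left_mono) auto
      then show ?thesis using True x by (simp add: attach_density_def)
    qed simp
  qed
  also have "\<dots> = ennreal (loop_prob k \<omega>)"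
    by (simp add: loop_prob_def ennreal_enn2real_attach_mass)
  finally show ?thesis using loop_prob_bounds by (simp add: W_def)
qed

text \<open>On a block from \<open>a\<close> to \<open>b\<close>, replacing each denominator
  \<open>W k\<close> by the larger \<open>W b\<close> makes the sum telescope to
  \<open>1 - W a / W b\<close>. The factor 1/2 comes from \<open>loop_prob_ge\<close>.\<close>

lemma loop_mean_ge_dyadic:
  assumes pos: "\<forall>i\<in>{1..m * n + 1}. 0 < w i \<omega>" and \<omega>: "\<omega> \<in> space M" and I: "2 ^ I \<le> m * n"
  shows "(\<Sum>i<I. 1 - partial_sum w (2 ^ i) \<omega> / partial_sum w (2 ^ Suc i) \<omega>) / 2 \<le> loop_mean \<omega>"
proof -
  define W where "W i = partial_sum w i \<omega>" for i
  have Wpos: "0 < W i" if "1 \<le> i" "i \<le> m * n + 1" for i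
    using partial_sum_pos[OF pos that] by (simp add: W_def)
  have Wmono: "W a \<le> W b" if "a \<le> b" "b \<le> m * n + 1" for a b
    using partial_sum_mono[OF pos that] by (simp add: W_def)
  have block: "1 - W a / W b \<le> (\<Sum>k=Suc a..b. w k \<omega> / W k)" if "1 \<le> a" "a \<le> b" "b \<le> m * n" for a b
  proof -
    have "1 - W a / W b = (W b - W a) / W b" using Wpos[of b] that by (simp add: field_simps)
    also have "\<dots> = (\<Sum>k=Suc a..b. w k \<omega> / W b)"
      using partial_sum_diff[OF that(2)] by (simp add: W_def sum_divide_distrib)
    also have "\<dots> \<le> (\<Sum>k=Suc a..b. w k \<omega> / W k)"
    proof (rule sum_mono)
      fix k assume k: "k \<in> {Suc a..b}"
      then have "0 < W k" "W k \<le> W b" "0 < w k \<omega>"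
        using that pos by (auto intro!: Wpos Wmono)
      then show "w k \<omega> / W b \<le> w k \<omega> / W k" by (intro divide_left_mono) auto
    qed
    finally show ?thesis .
  qed
  have "(\<Sum>i<I. 1 - W (2 ^ i) / W (2 ^ Suc i)) \<le> (\<Sum>k=1..2 ^ I. w k \<omega> / W k)"
    using I
  proof (induction I)
    case 0
    \<comment> \<open>There are no blocks yet, and the term \<open>k = 1\<close> on the right is
      nonnegative.\<close>
    have "0 < W 1" "0 < w 1 \<omega>" using pos 0 by (auto intro!: Wpos)
    then show ?case by simp
  next
    case (Suc I)
    have le: "(2::nat) ^ I \<le> 2 ^ Suc I" by simp
    have "{1..(2::nat) ^ Suc I} = {1..2 ^ I} \<union> {Suc (2 ^ I)..2 ^ Suc I}" by auto
    then have "(\<Sum>k=1..2 ^ Suc I. w k \<omega> / W k) =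
        (\<Sum>k=1..2 ^ I. w k \<omega> / W k) + (\<Sum>k=Suc (2 ^ I)..2 ^ Suc I. w k \<omega> / W k)"
      by (simp only:) (rule sum.union_disjoint, auto)
    moreover have "1 - W (2 ^ I) / W (2 ^ Suc I) \<le> (\<Sum>k=Suc (2 ^ I)..2 ^ Suc I. w k \<omega> / W k)"
      by (intro block le Suc.prems) simp
    ultimately show ?case using Suc.IH Suc.prems le by simp
  qed
  also have "\<dots> \<le> (\<Sum>k=1..m * n. w k \<omega> / W k)"
  proof (rule sum_mono2)
    fix k assume "k \<in> {1..m * n} - {1..2 ^ I}"
    then have "0 < W k" "0 < w k \<omega>" using pos by (auto intro!: Wpos)
    then show "0 \<le> w k \<omega> / W k" by simp
  qed (use I in auto)
  also have "\<dots> \<le> (\<Sum>k=1..m * n. 2 * loop_prob k \<omega>)"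
  proof (rule sum_mono)
    fix k assume "k \<in> {1..m * n}"
    then have "2 * (w k \<omega> / (2 * W k)) \<le> 2 * loop_prob k \<omega>"
      using loop_prob_ge[OF pos \<omega>] unfolding W_def by (intro mult_left_mono) auto
    then show "w k \<omega> / W k \<le> 2 * loop_prob k \<omega>" by simp
  qed
  also have "\<dots> = 2 * loop_mean \<omega>" by (simp add: loop_mean_def sum_distrib_left)
  finally show ?thesis by (simp add: W_def)
qed

section \<open>Concentration of the partial sums and of the conditional mean\<close>

text \<open>The sum of \<open>k\<close> independent standard exponentials is Erlang distributed with
  mean and variance \<open>k\<close>; Chebyshev's inequality at distance \<open>k / 8\<close> gives
  \<open>64 / k\<close>.\<close>

lemma prob_partial_sum_deviation:
  assumes k: "k \<in> {1..m * n + 1}"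
  shows "prob {\<omega> \<in> space M. k / 8 \<le> \<bar>partial_sum w k \<omega> - k\<bar>} \<le> 64 / k"
proof -
  have "distributed M lborel (\<lambda>\<omega>. \<Sum>i\<in>{1..k}. w i \<omega>) (erlang_density (card {1..k} - 1) 1)"
    using k by (intro exponential_distributed_sum exponential_w indep_vars_subset[OF indep_w]) auto
  \<comment> \<open>The first parameter of \<open>erlang_density\<close> is the shape minus
    one.\<close>
  then have D: "distributed M lborel (partial_sum w k) (erlang_density (k - 1) 1)"
    by (simp add: partial_sum_def[abs_def])
  have var: "variance (partial_sum w k) = k"
    using erlang_distributed_variance[OF _ D] k by simp
  have exp: "expectation (partial_sum w k) = k"
    using erlang_ith_moment[OF _ D, of 1] k by (simp add: fact_reduce)
  have "prob {\<omega> \<in> space M. k / 8 \<le> \<bar>partial_sum w k \<omega> - expectation (partial_sum w k)\<bar>} \<le>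
      variance (partial_sum w k) / (k / 8)\<^sup>2"
    using k erlang_ith_moment_integrable[OF _ D, of 2]
    by (intro Chebyshev_inequality partial_sum_measurable) auto
  also have "\<dots> = 64 / k" unfolding var using k by (simp add: power2_eq_square field_simps)
  finally show ?thesis unfolding exp .
qed

text \<open>If all sums at \<open>2 ^ i\<close> with \<open>i\<close> from \<open>h\<close> to
  \<open>I\<close> are within a factor 1/8 of their means, each of the \<open>I - h\<close> blocks
  contributes at least 5/14, and halving gives 5/28. The failure probabilities form a geometric
  series dominated by its first term, which is why the blocks below \<open>h\<close> are given
  up.\<close>

lemma prob_loop_mean_small:
  assumes I: "2 ^ I \<le> m * n" and h: "h \<le> I"
  shows "prob {\<omega> \<in> space M. loop_mean \<omega> < 5 / 28 * real (I - h)} \<le> 128 / 2 ^ h"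
proof -
  define bad where "bad i = {\<omega> \<in> space M. real (2 ^ i) / 8 \<le> \<bar>partial_sum w (2 ^ i) \<omega> - real (2 ^ i)\<bar>}" for i
  have le: "(2::nat) ^ i \<le> m * n" if "i \<le> I" for i
    using that I order_trans[OF power_increasing[of i I "2::nat"]] by simp
  have bad_meas: "bad i \<in> sets M" if "i \<le> I" for i
  proof -
    have [measurable]: "partial_sum w (2 ^ i) \<in> borel_measurable M"
      using le[OF that] by (intro partial_sum_measurable) simp
    show ?thesis unfolding bad_def by measurable
  qed
  have [measurable]: "loop_mean \<in> borel_measurable M"
    by (rule measurable_from_subalg[OF subalg loop_mean_measurable])
  have "prob {\<omega> \<in> space M. loop_mean \<omega> < 5 / 28 * real (I - h)} \<le> prob (\<Union>i\<in>{h..I}. bad i)"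
  proof (rule finite_measure_mono_AE)
    show "AE \<omega> in M. \<omega> \<in> {\<omega> \<in> space M. loop_mean \<omega> < 5 / 28 * real (I - h)} \<longrightarrow> \<omega> \<in> (\<Union>i\<in>{h..I}. bad i)"
      using AE_w_pos
    proof eventually_elim
      case (elim \<omega>)
      show ?case
      proof (rule impI, rule ccontr)
        assume \<omega>: "\<omega> \<in> {\<omega> \<in> space M. loop_mean \<omega> < 5 / 28 * real (I - h)}"
          and good: "\<omega> \<notin> (\<Union>i\<in>{h..I}. bad i)"
        define V where "V i = partial_sum w (2 ^ i) \<omega>" for i
        have V: "\<bar>V i - 2 ^ i\<bar> < 2 ^ i / 8" if "i \<in> {h..I}" for i
          using good \<omega> that by (force simp: bad_def V_def)
        have "5 / 14 * real (I - h) = (\<Sum>i\<in>{h..<I}. 5 / 14)" by simp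
        also have "\<dots> \<le> (\<Sum>i\<in>{h..<I}. 1 - V i / V (Suc i))"
        proof (rule sum_mono)
          fix i assume "i \<in> {h..<I}"
          then have "\<bar>V i - 2 ^ i\<bar> < 2 ^ i / 8" "\<bar>V (Suc i) - 2 * 2 ^ i\<bar> < 2 * 2 ^ i / 8"
            using V[of i] V[of "Suc i"] by auto
          \<comment> \<open>The extreme ratio is 9/8 divided by twice 7/8, that is 9/14.\<close>
          then have "V i \<le> 9 / 14 * V (Suc i)" "0 < V (Suc i)"
            using zero_less_power[of "2::real" i] by linarith+
          then show "5 / 14 \<le> 1 - V i / V (Suc i)" by (simp add: field_simps)
        qed
        \<comment> \<open>The blocks below \<open>h\<close> need no concentration: their terms are
          nonnegative because the partial sums increase.\<close>
        also have "\<dots> \<le> (\<Sum>i<I. 1 - V i / V (Suc i))"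
        proof (rule sum_mono2)
          fix i assume "i \<in> {..<I} - {h..<I}"
          then have "(2::nat) ^ Suc i \<le> m * n" by (intro le) auto
          then have "V i \<le> V (Suc i)" "0 < V (Suc i)"
            unfolding V_def by (auto intro!: partial_sum_mono partial_sum_pos elim)
          then show "0 \<le> 1 - V i / V (Suc i)" by simp
        qed auto
        also have "\<dots> \<le> 2 * loop_mean \<omega>"
          using loop_mean_ge_dyadic[OF elim _ I] \<omega> by (simp add: V_def)
        finally show False using \<omega> by simp
      qed
    qed
  qed (use bad_meas in auto)
  also have "\<dots> \<le> (\<Sum>i\<in>{h..I}. prob (bad i))"
    using bad_meas by (intro finite_measure_subadditive_finite) auto
  also have "\<dots> \<le> (\<Sum>i\<in>{h..I}. 64 / 2 ^ i)"
  proof (rule sum_mono)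
    fix i assume "i \<in> {h..I}"
    then show "prob (bad i) \<le> 64 / 2 ^ i"
      using prob_partial_sum_deviation[of "2 ^ i"] le[of i] by (simp add: bad_def)
  qed
  also have "\<dots> = 128 / 2 ^ h - 64 / 2 ^ I"
    using h by (induction rule: dec_induct) auto
  also have "\<dots> \<le> 128 / 2 ^ h" by simp
  finally show ?thesis .
qed

section \<open>Choice of parameters and the final rate\<close>

text \<open>The event is split according to whether \<open>loop_mean\<close> reaches a threshold
  \<open>t\<close> proportional to \<open>I\<close>, the integer part of the binary logarithm of
  \<open>n\<close>. Chebyshev's inequality treats one part, the lower tail of
  \<open>loop_mean\<close> the other; both are of order \<open>1 / I\<close>.\<close>

lemma prob_num_loops_deviation_le:
  assumes "m \<ge> 1" "n \<ge> 2" and \<epsilon>: "0 < \<epsilon>"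
  shows "prob {\<omega> \<in> space M. \<bar>num_loops m n w l \<omega> - cond_num_loops m n M w l \<omega>\<bar>
      \<ge> \<epsilon> * cond_num_loops m n M w l \<omega>} \<le> (24 / \<epsilon>\<^sup>2 + 512) / ln n"
proof -
  let ?L = "num_loops m n w l" and ?C = "cond_num_loops m n M w l" and ?P = loop_mean
  obtain I where I: "2 ^ I \<le> n" "n < 2 ^ (I + 1)"
    using ex_power_ivl1[of 2 n] assms(2) by auto
  have I1: "1 \<le> I" using I(2) assms(2) by (cases I) auto
  \<comment> \<open>Giving up half of the blocks leaves at least \<open>I / 2\<close> of them for
    the mean, while the failure bound \<open>128 / 2 ^ h\<close> becomes exponentially small in
    \<open>I\<close>.\<close>
  define h where "h = I div 2"
  define t where "t = 5 / 28 * real (I - h)"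
  have hI: "h \<le> I" "real I / 2 \<le> real (I - h)" "real I / 2 \<le> real (h + 1)" by (auto simp: h_def)
  have t: "5 / 56 * real I \<le> t" using hI by (simp add: t_def)
  have t0: "0 < t"
  proof -
    have "0 < 5 / 56 * real I" using I1 by simp
    then show ?thesis using t by linarith
  qed
  have PM[measurable]: "?P \<in> borel_measurable M"
    by (rule measurable_from_subalg[OF subalg loop_mean_measurable])
  have LM[measurable]: "?L \<in> borel_measurable M" by (rule num_loops_measurable)
  have CM[measurable]: "?C \<in> borel_measurable M" unfolding cond_num_loops_def by simp
  let ?S = "{\<omega> \<in> space M. \<bar>?L \<omega> - ?P \<omega>\<bar> \<ge> \<epsilon> * ?P \<omega> \<and> ?P \<omega> \<ge> t}"
  let ?T = "{\<omega> \<in> space M. ?P \<omega> < t}"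
  have "prob {\<omega> \<in> space M. \<bar>?L \<omega> - ?C \<omega>\<bar> \<ge> \<epsilon> * ?C \<omega>} \<le> prob (?S \<union> ?T)"
    using cond_num_loops_eq by (intro finite_measure_mono_AE) auto
  also have "\<dots> \<le> prob ?S + prob ?T" by (intro measure_Un_le) auto
  also have "\<dots> \<le> 1 / (\<epsilon>\<^sup>2 * t) + 128 / 2 ^ h"
  proof (rule add_mono)
    show "prob ?S \<le> 1 / (\<epsilon>\<^sup>2 * t)" by (rule prob_num_loops_deviation[OF t0 \<epsilon>])
    have "n \<le> m * n" using assms(1) by simp
    then have "2 ^ I \<le> m * n" using I(1) by linarith
    then show "prob ?T \<le> 128 / 2 ^ h"
      unfolding t_def by (rule prob_loop_mean_small[OF _ hI(1)])
  qed
  also have "\<dots> \<le> 1 / (\<epsilon>\<^sup>2 * (I / 12)) + 128 / (I / 2)"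
  proof (intro add_mono divide_left_mono mult_left_mono)
    \<comment> \<open>The constant 5/56 is rounded down to 1/12.\<close>
    show "I / 12 \<le> t" using t by simp
    \<comment> \<open>The exponential decay is weakened to \<open>2 / I\<close>, enough to match the
      Chebyshev term.\<close>
    have "h + 1 \<le> 2 ^ h" using less_exp[of h] by linarith
    then have "real (h + 1) \<le> 2 ^ h" by (metis of_nat_le_iff of_nat_numeral of_nat_power)
    then show "I / 2 \<le> 2 ^ h" using hI by linarith
  qed (use \<epsilon> t0 I1 in auto)
  also have "\<dots> = (12 / \<epsilon>\<^sup>2 + 256) / I" using I1 \<epsilon> by (simp add: field_simps)
  also have "\<dots> \<le> (12 / \<epsilon>\<^sup>2 + 256) / (ln n / 2)"
  proof (intro divide_left_mono)
    \<comment> \<open>Since \<open>ln 2 < 1\<close> and \<open>1 \<le> I\<close>,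
      \<open>ln n\<close> is at most \<open>I + 1\<close> and hence at most
      \<open>2 * I\<close>.\<close>
    have "real n \<le> real (2 ^ (I + 1))" using I(2) by (simp only: of_nat_le_iff)
    then have "ln n \<le> ln (2 ^ (I + 1))" using assms(2) by simp
    also have "\<dots> = (I + 1) * ln 2" by (subst ln_realpow) auto
    also have "\<dots> \<le> real (I + 1) * 1" using ln_2_less_1 by (intro mult_left_mono) auto
    finally show "ln n / 2 \<le> I" using I1 by simp
  qed (use \<epsilon> I1 assms(2) in auto)
  also have "\<dots> = (24 / \<epsilon>\<^sup>2 + 512) / ln n" using assms(2) by (simp add: field_simps)
  finally show ?thesis .
qed

end

theorem theorem2p5:
  fixes m :: nat
    and M :: "nat \<Rightarrow> 'a measure"
    and w l :: "nat \<Rightarrow> nat \<Rightarrow> 'a \<Rightarrow> real"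
    and \<epsilon> \<delta> :: real
  assumes "m \<ge> 1"
    and "\<And>n. n \<ge> 1 \<Longrightarrow> bollobas_riordan (M n) m n (w n) (l n)"
    and "0 < \<epsilon>" "\<epsilon> < 3 / 2"
    and "0 < \<delta>" "\<delta> < 1"
  shows "(\<lambda>n. measure (M n) {\<omega> \<in> space (M n).
            \<bar>num_loops m n (w n) (l n) \<omega> - cond_num_loops m n (M n) (w n) (l n) \<omega>\<bar>
              \<ge> \<epsilon> * cond_num_loops m n (M n) (w n) (l n) \<omega>})
         \<in> O(\<lambda>n. ln (real n) powr (- (1 - \<delta>)))"
proof (rule bigoI)
  show "\<forall>\<^sub>F n in sequentially. norm (measure (M n) {\<omega> \<in> space (M n).
            \<bar>num_loops m n (w n) (l n) \<omega> - cond_num_loops m n (M n) (w n) (l n) \<omega>\<bar>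
              \<ge> \<epsilon> * cond_num_loops m n (M n) (w n) (l n) \<omega>}) \<le>
          (24 / \<epsilon>\<^sup>2 + 512) * norm (ln (real n) powr (- (1 - \<delta>)))"
    using eventually_ge_at_top[of 3]
  proof eventually_elim
    case (elim n)
    interpret bollobas_riordan "M n" m n "w n" "l n" using assms(2) elim by simp
    \<comment> \<open>This is where \<open>n \<ge> 3\<close> enters, through
      \<open>exp 1 \<le> 3\<close>. With base at least 1 the power increases with its exponent, so
      the rate with exponent -1 is below the one with exponent
      \<open>- (1 - \<delta>)\<close>.\<close>
    have ln1: "1 \<le> ln (real n)"
    proof -
      have "exp 1 \<le> real n" using exp_le elim by linarith
      then show ?thesis using elim by (subst ln_ge_iff) auto
    qed
    have "1 / ln (real n) = ln (real n) powr (-1)" using ln1 by (simp add: powr_minus_divide)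
    also have "\<dots> \<le> ln (real n) powr (- (1 - \<delta>))" using ln1 assms by (intro powr_mono) auto
    finally have "(24 / \<epsilon>\<^sup>2 + 512) * (1 / ln (real n)) \<le>
        (24 / \<epsilon>\<^sup>2 + 512) * ln (real n) powr (- (1 - \<delta>))"
      by (intro mult_left_mono) auto
    then show ?case
      using prob_num_loops_deviation_le[OF assms(1) _ assms(3)] elim by simp
  qed
qed

end
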